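(* Let $N,K,T,M\ge 1$ and $B\ge 0$ be integers with $T+K\le N$ and $2\binom{N-B}{K}-\binom{N}{K}>\binom{N}{K}-\binom{N-T}{K}$. Then, for every sufficiently large prime power $q$ and every generator matrix $\mathbf{G}\in\mathbb{F}_q^{K\times N}$ of an $(N,K)$-MDS code, there exist a positive integer $L$ and an $(N,K,T;M)$-PIR scheme with $B$ Byzantine servers, for $M$ files in $\mathbb{F}_q^{L\times K}$ stored via $\mathbf{G}$, whose rate is $$\frac{2\binom{N-B}{K}-\binom{N}{K}}{\binom{N}{K}}\left(1+R+R^2+\cdots+R^{M-1}\right)^{-1},\qquad\text{where } R=\frac{\binom{N}{K}-\binom{N-T}{K}}{2\binom{N-B}{K}-\binom{N}{K}}.$$
   Context: Storage. There are $N$ servers and $M$ files $W^{[1]},\dots,W^{[M]}\in\mathbb{F}_q^{L\times K}$, independent and uniformly distributed (entropies are in $q$-ary units, so $H(W^{[i]})=LK$ and $H(W^{[1]},\dots,W^{[M]})=MLK$). Let $\mathbf{G}=[\mathbf{g}_1\ \cdots\ \mathbf{g}_N]\in\mathbb{F}_q^{K\times N}$ have the MDS property: any $K$ columns are linearly independent. Server $n$ stores $\mathbf{y}_n=(W^{[1]}\mathbf{g}_n,\dots,W^{[M]}\mathbf{g}_n)\in\mathbb{F}_q^{ML}$. PIR scheme with $B$ Byzantine servers. The user wants file $W^{[i]}$. There is a random variable $\mathcal{F}$ (the user's randomness for generating queries, unknown to the servers) and a random variable $\mathcal{G}$ (the servers' randomness for producing feedbacks, also known to the user; it may be deterministic);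 $\mathcal{F},\mathcal{G},i,W^{[1]},\dots,W^{[M]}$ are mutually independent. Using $\mathcal F$, the user generates queries $Q^{[i]}_1,\dots,Q^{[i]}_N$, with $Q^{[i]}_n$ sent to server $n$, such that $I(Q^{[i]}_1,\dots,Q^{[i]}_N;W^{[1]},\dots,W^{[M]})=0$. The correct feedback $A^{[i]}_n$ of server $n$ is a deterministic function of $Q^{[i]}_n,\mathcal{G},\mathbf{y}_n$. There is a set $\mathcal{B}\subseteq\{1,\dots,N\}$ of $B$ Byzantine servers, unknown to the user: servers $n\notin\mathcal{B}$ return $A^{[i]}_n$, while servers $n\in\mathcal{B}$ may return arbitrary (possibly coordinated and incorrect) answers of the same format. The requirements are: - Correctness: for every set $\mathcal{B}$ of $B$ servers and every choice of the answers returned by the servers in $\mathcal{B}$, the user can determine $W^{[i]}$ from all queries, all $N$ returned answers, $\mathcal{F}$ and $\mathcal{G}$, without knowing $\mathcal{B}$. - Privacy: for every $\mathcal{T}\subseteq\{1,\dots,N\}$ with $|\mathcal{T}|=T$, $I(i;Q^{[i]}_{\mathcal{T}})=I(i;A^{[i]}_{\mathcal{T}})=0$, where $Q^{[i]}_{\mathcal{T}}=\{Q^{[i]}_n:n\in\mathcal{T}\}$ and $A^{[i]}_{\mathcal{T}}=\{A^{[i]}_n:n\in\mathcal{T}\}$. No relation between $\mathcal{T}$ and $\mathcal{B}$ is assumed. Rate: $H(W^{[i]})/\sum_{n=1}^N H(A^{[i]}_n)$ (the answer of a Byzantine server counts with the same size as its correct feedback). *)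

theory Defs
  imports "HOL-Probability.Probability" "HOL-Algebra.Ring"
begin

text \<open>
  Finite fields are records of HOL-Algebra rather than a type of class \<open>field\<close>, because the field
  has to be quantified inside a formula ("for every sufficiently large \<open>q\<close>"), after the threshold
  on \<open>q\<close> has been chosen. A matrix is an extensional function of the row and column indices;
  servers, files, rows and columns are numbered from \<open>0\<close>.
\<close>

definition matrices :: "'e ring \<Rightarrow> nat \<Rightarrow> nat \<Rightarrow> (nat \<Rightarrow> nat \<Rightarrow> 'e) set" where
  "matrices F r c = {..<r} \<rightarrow>\<^sub>E ({..<c} \<rightarrow>\<^sub>E carrier F)"

definition mds_matrix :: "'e ring \<Rightarrow> nat \<Rightarrow> nat \<Rightarrow> (nat \<Rightarrow> nat \<Rightarrow> 'e) \<Rightarrow> bool" where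
  "mds_matrix F N K G \<longleftrightarrow> G \<in> matrices F K N \<and>
     (\<forall>S \<subseteq> {..<N}. card S = K \<longrightarrow>
        (\<forall>c \<in> S \<rightarrow> carrier F.
           (\<forall>k<K. (\<Oplus>\<^bsub>F\<^esub>n\<in>S. c n \<otimes>\<^bsub>F\<^esub> G k n) = \<zero>\<^bsub>F\<^esub>) \<longrightarrow> (\<forall>n\<in>S. c n = \<zero>\<^bsub>F\<^esub>)))"

definition file_tuples :: "'e ring \<Rightarrow> nat \<Rightarrow> nat \<Rightarrow> nat \<Rightarrow> (nat \<Rightarrow> nat \<Rightarrow> nat \<Rightarrow> 'e) set" where
  "file_tuples F K M L = {..<M} \<rightarrow>\<^sub>E matrices F L K"

definition stored ::
  "'e ring \<Rightarrow> nat \<Rightarrow> nat \<Rightarrow> nat \<Rightarrow> (nat \<Rightarrow> nat \<Rightarrow> 'e) \<Rightarrow> (nat \<Rightarrow> nat \<Rightarrow> nat \<Rightarrow> 'e) \<Rightarrow> nat \<Rightarrow> (nat \<Rightarrow> nat \<Rightarrow> 'e)"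
where
  "stored F K M L G W n = (\<lambda>m\<in>{..<M}. \<lambda>l\<in>{..<L}. \<Oplus>\<^bsub>F\<^esub>k\<in>{..<K}. W m l k \<otimes>\<^bsub>F\<^esub> G k n)"

text \<open>Entropy and mutual information, in base \<open>b\<close>, of discrete random variables on the probability
  space given by \<open>p\<close>.\<close>

definition pmf_entropy :: "real \<Rightarrow> 'w pmf \<Rightarrow> ('w \<Rightarrow> 'x) \<Rightarrow> real" where
  "pmf_entropy b p X = prob_space.entropy (measure_pmf p) b (count_space UNIV) X"

definition pmf_mutual_information :: "real \<Rightarrow> 'w pmf \<Rightarrow> ('w \<Rightarrow> 'x) \<Rightarrow> ('w \<Rightarrow> 'y) \<Rightarrow> real" where
  "pmf_mutual_information b p X Y =
     prob_space.mutual_information (measure_pmf p) b (count_space UNIV) (count_space UNIV) X Y"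

text \<open>
  \<open>query i f n\<close> is the query to server \<open>n\<close> when file \<open>i\<close> is wanted and the user's randomness
  is \<open>f\<close>; \<open>answer n q g y\<close> is the correct feedback of server \<open>n\<close> to the query \<open>q\<close> when the servers'
  randomness is \<open>g\<close> and the server stores \<open>y\<close>; \<open>alphabet n\<close> is the format of the answers of server \<open>n\<close>;
  \<open>decode i qs as f g\<close> is the user's reconstruction from all the queries and all the returned answers.
\<close>

record ('f, 'g, 'q, 'a, 'e) pir =
  user_rand :: "'f pmf"
  server_rand :: "'g pmf"
  query :: "nat \<Rightarrow> 'f \<Rightarrow> nat \<Rightarrow> 'q"
  alphabet :: "nat \<Rightarrow> 'a set"
  answer :: "nat \<Rightarrow> 'q \<Rightarrow> 'g \<Rightarrow> (nat \<Rightarrow> nat \<Rightarrow> 'e) \<Rightarrow> 'a"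
  decode :: "nat \<Rightarrow> (nat \<Rightarrow> 'q) \<Rightarrow> (nat \<Rightarrow> 'a) \<Rightarrow> 'f \<Rightarrow> 'g \<Rightarrow> (nat \<Rightarrow> nat \<Rightarrow> 'e)"

text \<open>The user's randomness, the servers' randomness and the files; the files are independent and
  uniform exactly when their tuple is uniform.\<close>

definition pir_space ::
  "'e ring \<Rightarrow> nat \<Rightarrow> nat \<Rightarrow> nat \<Rightarrow> ('f, 'g, 'q, 'a, 'e) pir
     \<Rightarrow> ('f \<times> 'g \<times> (nat \<Rightarrow> nat \<Rightarrow> nat \<Rightarrow> 'e)) pmf"
where
  "pir_space F K M L S =
     pair_pmf (user_rand S) (pair_pmf (server_rand S) (pmf_of_set (file_tuples F K M L)))"

definition queries ::
  "('f, 'g, 'q, 'a, 'e) pir \<Rightarrow> nat \<Rightarrow> 'f \<times> 'g \<times> (nat \<Rightarrow> nat \<Rightarrow> nat \<Rightarrow> 'e) \<Rightarrow> nat \<Rightarrow> 'q"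
where
  "queries S i = (\<lambda>(f, g, W) n. query S i f n)"

definition feedbacks ::
  "'e ring \<Rightarrow> nat \<Rightarrow> nat \<Rightarrow> nat \<Rightarrow> (nat \<Rightarrow> nat \<Rightarrow> 'e) \<Rightarrow> ('f, 'g, 'q, 'a, 'e) pir
     \<Rightarrow> nat \<Rightarrow> 'f \<times> 'g \<times> (nat \<Rightarrow> nat \<Rightarrow> nat \<Rightarrow> 'e) \<Rightarrow> nat \<Rightarrow> 'a"
where
  "feedbacks F K M L G S i =
     (\<lambda>(f, g, W) n. answer S n (query S i f n) g (stored F K M L G W n))"

definition well_formed_pir ::
  "'e ring \<Rightarrow> nat \<Rightarrow> nat \<Rightarrow> nat \<Rightarrow> nat \<Rightarrow> (nat \<Rightarrow> nat \<Rightarrow> 'e) \<Rightarrow> ('f, 'g, 'q, 'a, 'e) pir \<Rightarrow> bool"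
where
  "well_formed_pir F N K M L G S \<longleftrightarrow>
     (\<forall>n<N. finite (alphabet S n)) \<and>
     (\<forall>i<M. \<forall>\<omega>\<in>set_pmf (pir_space F K M L S). \<forall>n<N.
        feedbacks F K M L G S i \<omega> n \<in> alphabet S n) \<and>
     (\<forall>i<M. pmf_mutual_information (card (carrier F)) (pir_space F K M L S)
        (\<lambda>\<omega>. restrict (queries S i \<omega>) {..<N}) (\<lambda>(f, g, W). W) = 0)"

definition pir_correct ::
  "'e ring \<Rightarrow> nat \<Rightarrow> nat \<Rightarrow> nat \<Rightarrow> nat \<Rightarrow> nat \<Rightarrow> (nat \<Rightarrow> nat \<Rightarrow> 'e) \<Rightarrow> ('f, 'g, 'q, 'a, 'e) pir \<Rightarrow> bool"
where
  "pir_correct F N K M B L G S \<longleftrightarrow>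
     (\<forall>i<M. \<forall>(f, g, W)\<in>set_pmf (pir_space F K M L S).
        \<forall>Byz \<subseteq> {..<N}. card Byz = B \<longrightarrow>
          (\<forall>a \<in> Pi\<^sub>E {..<N} (alphabet S).
             (\<forall>n\<in>{..<N} - Byz. a n = feedbacks F K M L G S i (f, g, W) n) \<longrightarrow>
             decode S i (restrict (queries S i (f, g, W)) {..<N}) a f g = W i))"

text \<open>The wanted index is a random variable independent of everything else; no distribution is
  prescribed for it, so privacy is required for all of them.\<close>

definition pir_private ::
  "'e ring \<Rightarrow> nat \<Rightarrow> nat \<Rightarrow> nat \<Rightarrow> nat \<Rightarrow> nat \<Rightarrow> (nat \<Rightarrow> nat \<Rightarrow> 'e) \<Rightarrow> ('f, 'g, 'q, 'a, 'e) pir \<Rightarrow> bool"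
where
  "pir_private F N K T M L G S \<longleftrightarrow>
     (\<forall>P :: nat pmf. set_pmf P \<subseteq> {..<M} \<longrightarrow>
        (\<forall>C \<subseteq> {..<N}. card C = T \<longrightarrow>
           pmf_mutual_information (card (carrier F)) (pair_pmf P (pir_space F K M L S))
             (\<lambda>(i, \<omega>). i) (\<lambda>(i, \<omega>). restrict (queries S i \<omega>) C) = 0 \<and>
           pmf_mutual_information (card (carrier F)) (pair_pmf P (pir_space F K M L S))
             (\<lambda>(i, \<omega>). i) (\<lambda>(i, \<omega>). restrict (feedbacks F K M L G S i \<omega>) C) = 0))"

definition byzantine_pir_scheme ::
  "'e ring \<Rightarrow> nat \<Rightarrow> nat \<Rightarrow> nat \<Rightarrow> nat \<Rightarrow> nat \<Rightarrow> nat \<Rightarrow> (nat \<Rightarrow> nat \<Rightarrow> 'e)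
     \<Rightarrow> ('f, 'g, 'q, 'a, 'e) pir \<Rightarrow> bool"
where
  "byzantine_pir_scheme F N K T M B L G S \<longleftrightarrow>
     well_formed_pir F N K M L G S \<and> pir_correct F N K M B L G S \<and> pir_private F N K T M L G S"

definition pir_rate ::
  "'e ring \<Rightarrow> nat \<Rightarrow> nat \<Rightarrow> nat \<Rightarrow> nat \<Rightarrow> (nat \<Rightarrow> nat \<Rightarrow> 'e) \<Rightarrow> ('f, 'g, 'q, 'a, 'e) pir \<Rightarrow> nat \<Rightarrow> real"
where
  "pir_rate F N K M L G S i =
     pmf_entropy (card (carrier F)) (pir_space F K M L S) (\<lambda>(f, g, W). W i) /
     (\<Sum>n<N. pmf_entropy (card (carrier F)) (pir_space F K M L S)
                (\<lambda>\<omega>. feedbacks F K M L G S i \<omega> n))"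

text \<open>
  A type cannot be existentially quantified, so schemes that are asserted to exist use \<open>nat\<close> for the
  randomness, the queries and the answers; any countable sets can be encoded in it. Likewise every
  finite field is isomorphic to one whose carrier is a set of natural numbers.
\<close>

type_synonym nat_pir = "(nat, nat, nat, nat, nat) pir"

end

theory Submission
  imports Defs "HOL-Algebra.Multiplicative_Group"
begin

text \<open>
  Put \<open>n = (N choose K)\<close>, \<open>D = 2 ((N - B) choose K) - n\<close> and \<open>I = n - ((N - T) choose K)\<close>. A block
  of downloads has one coordinate for every \<open>K\<close>-set of servers: all servers of the \<open>K\<close>-set
  receive the same query vectors, so that they jointly reveal a full row of \<open>K\<close> symbols. \<open>T\<close> servers see
  \<open>I\<close> of the \<open>n\<close> coordinates of a block. Two candidate Byzantine sets together spoil at most \<open>n - D\<close>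
  coordinates, so a Reed-Solomon code of length \<open>n\<close> and dimension \<open>D\<close> per block is decoded uniquely.

  As in the scheme of Sun and Jafar, every nonempty set of files has blocks in which
  combinations of all its files are added up. For a set \<open>\<Gamma>\<close> without the wanted file \<open>i\<close>, the
  coefficients in the blocks of \<open>\<Gamma>\<close> and of \<open>insert i \<Gamma>\<close> form one common codeword that is determined
  by the blocks of \<open>\<Gamma>\<close> alone; subtracting it leaves the wanted file, which is encoded by a code of
  full dimension \<open>L = D ^ M\<close>. Each file enters through a random invertible \<open>L\<close> by \<open>L\<close> matrix. For every
  file, wanted or not, the coefficient vectors seen by \<open>T\<close> servers are linearly independent, hence
  their view has the same distribution whichever file is wanted. Privacy and the entropies of the
  answers both follow from this.
\<close>

section \<open>Entropy and mutual information of discrete variables\<close>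

text \<open>The obstacle is that interference must be cheap to recover and yet look fresh. The
  common codeword of the unwanted files in \<Gamma> has to be determined by the clean coordinates of
  the blocks of \<Gamma> alone, so its dimension is at most \<open>D\<close> per such block; to hide
  which file is wanted, its dimension must be at least the number of coordinates that
  \<open>T\<close> servers see in the blocks of \<Gamma> and of \<open>insert i \<Gamma>\<close>
  together. Equating the two bounds, with \<open>b s\<close> blocks for each set of \<open>s\<close>
  files, gives \<open>I * (b s + b (s + 1)) = D * b s\<close>, hence the ratio
  \<open>(D - I) / I\<close> between consecutive numbers. This is where the formula
  \<open>blocks\<close> and the geometric series with \<open>R = I / D\<close> in the rate come
  from; the hypothesis of the theorem says \<open>I < D\<close>. By the binomial theorem each file
  lies in \<open>D ^ (M - 1)\<close> blocks, every one of which yields \<open>D\<close> symbols,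
  hence \<open>L = D ^ M\<close>. Every coordinate of the whole scheme gets its own evaluation
  point, so that one Vandermonde family supplies the codes of all dimensions; the number of
  coordinates is the bound on \<open>q\<close>.\<close>

lemma pmf_mutual_information_eq_0:
  assumes "1 < b" and "map_pmf (\<lambda>\<omega>. (X \<omega>, Y \<omega>)) p = pair_pmf (map_pmf X p) (map_pmf Y p)"
  shows "pmf_mutual_information b p X Y = 0"
proof -
  interpret information_space "measure_pmf p" b
    using assms(1) by unfold_locales auto
  have prod: "measure (measure_pmf p) (X -` A \<inter> Y -` C)
      = measure (measure_pmf p) (X -` A) * measure (measure_pmf p) (Y -` C)" for A C
  proof -
    have "measure (measure_pmf p) (X -` A \<inter> Y -` C)
        = measure (map_pmf (\<lambda>\<omega>. (X \<omega>, Y \<omega>)) p) (A \<times> C)"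
      by (simp add: vimage_def Collect_conj_eq)
    also have "\<dots> = measure (pair_pmf (map_pmf X p) (map_pmf Y p)) (A \<times> C)"
      by (simp only: assms(2))
    also have "\<dots> = measure (map_pmf X p) A * measure (map_pmf Y p) C"
    proof -
      have "emeasure (pair_pmf (map_pmf X p) (map_pmf Y p)) (A \<times> C)
         = (\<integral>\<^sup>+ z. indicator (A \<times> C) z \<partial>pair_pmf (map_pmf X p) (map_pmf Y p))" by simp
      also have "\<dots> = emeasure (map_pmf X p) A * emeasure (map_pmf Y p) C"
        unfolding nn_integral_pair_pmf'
        by (simp add: indicator_times nn_integral_cmult nn_integral_multc del: nn_integral_map_pmf emeasure_map_pmf)
      finally show ?thesis
        by (simp add: measure_pmf.emeasure_eq_measure ennreal_mult[symmetric] del: emeasure_map_pmf measure_map_pmf)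
    qed
    finally show ?thesis by simp
  qed
  interpret A: prob_space "distr (measure_pmf p) (count_space UNIV) X"
    by (rule measure_pmf.prob_space_distr) simp
  interpret C: prob_space "distr (measure_pmf p) (count_space UNIV) Y"
    by (rule measure_pmf.prob_space_distr) simp
  interpret AC: pair_prob_space "distr (measure_pmf p) (count_space UNIV) X" "distr (measure_pmf p) (count_space UNIV) Y" ..
  \<comment> \<open>The measures are compared on rectangles: for uncountable types the product of
    two count spaces may have fewer measurable sets than the count space of the product.\<close>
  have eq: "distr (measure_pmf p) (count_space UNIV) X \<Otimes>\<^sub>M distr (measure_pmf p) (count_space UNIV) Y
     = distr (measure_pmf p) (count_space UNIV \<Otimes>\<^sub>M count_space UNIV) (\<lambda>x. (X x, Y x))"
  proof (rule pair_measure_eqI)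
    fix D E
    have m: "(\<lambda>x. (X x, Y x)) \<in> measurable (measure_pmf p) (count_space UNIV \<Otimes>\<^sub>M count_space UNIV)"
      by (intro measurable_Pair) simp_all
    have "(\<lambda>x. (X x, Y x)) -` (D \<times> E) = X -` D \<inter> Y -` E" by auto
    moreover have DE: "D \<times> E \<in> sets (count_space UNIV \<Otimes>\<^sub>M count_space UNIV)"
      by (rule pair_measureI) simp_all
    ultimately show "emeasure (distr (measure_pmf p) (count_space UNIV) X) D
        * emeasure (distr (measure_pmf p) (count_space UNIV) Y) E
      = emeasure (distr (measure_pmf p) (count_space UNIV \<Otimes>\<^sub>M count_space UNIV) (\<lambda>x. (X x, Y x))) (D \<times> E)"
      unfolding emeasure_distr[OF m DE]
      by (simp add: emeasure_distr measure_pmf.emeasure_eq_measure prod ennreal_mult)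
  next
    show "sets (distr (measure_pmf p) (count_space UNIV) X \<Otimes>\<^sub>M distr (measure_pmf p) (count_space UNIV) Y)
      = sets (distr (measure_pmf p) (count_space UNIV \<Otimes>\<^sub>M count_space UNIV) (\<lambda>x. (X x, Y x)))"
      unfolding sets_distr by (rule sets_pair_measure_cong) (rule sets_distr)+
  qed (fact A.sigma_finite_measure_axioms C.sigma_finite_measure_axioms)+
  show ?thesis
    unfolding pmf_mutual_information_def eq[symmetric]
      prob_space.mutual_information_def[OF measure_pmf.prob_space_axioms]
    by (rule AC.KL_same_eq_0)
qed

text \<open>All indices in the support give the same law \<mu>, so index and observation are jointly
  distributed as \<open>pair_pmf P \<mu>\<close>. Both privacy conditions thus reduce to laws that
  do not depend on the wanted index.\<close>

lemma pmf_mutual_information_index_eq_0: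
  assumes "1 < b" and "\<And>i. i \<in> set_pmf P \<Longrightarrow> map_pmf (Y i) p = \<mu>"
  shows "pmf_mutual_information b (pair_pmf P p) (\<lambda>(i, \<omega>). i) (\<lambda>(i, \<omega>). Y i \<omega>) = 0"
proof (rule pmf_mutual_information_eq_0[OF assms(1)])
  have joint: "map_pmf (\<lambda>(i, \<omega>). (i, Y i \<omega>)) (pair_pmf P p) = pair_pmf P \<mu>"
  proof -
    have "map_pmf (\<lambda>(i, \<omega>). (i, Y i \<omega>)) (pair_pmf P p)
        = bind_pmf P (\<lambda>i. map_pmf (Pair i) (map_pmf (Y i) p))"
      by (simp add: pair_pmf_def map_bind_pmf map_pmf_comp map_pmf_def bind_assoc_pmf bind_return_pmf)
    also have "\<dots> = bind_pmf P (\<lambda>i. map_pmf (Pair i) \<mu>)"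
      using assms(2) by (intro bind_pmf_cong) auto
    also have "\<dots> = pair_pmf P \<mu>"
      by (simp add: pair_pmf_def map_pmf_def)
    finally show ?thesis .
  qed
  have "map_pmf (\<lambda>(i, \<omega>). Y i \<omega>) (pair_pmf P p) = map_pmf snd (pair_pmf P \<mu>)"
    by (simp add: joint[symmetric] map_pmf_comp case_prod_unfold)
  moreover have "map_pmf (\<lambda>(i, \<omega>). i) (pair_pmf P p) = P"
    by (simp add: case_prod_unfold map_fst_pair_pmf)
  ultimately show "map_pmf (\<lambda>\<omega>. (case \<omega> of (i, \<omega>) \<Rightarrow> i, case \<omega> of (i, \<omega>) \<Rightarrow> Y i \<omega>)) (pair_pmf P p)
     = pair_pmf (map_pmf (\<lambda>(i, \<omega>). i) (pair_pmf P p)) (map_pmf (\<lambda>(i, \<omega>). Y i \<omega>) (pair_pmf P p))"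
    using joint by (simp add: map_snd_pair_pmf case_prod_unfold)
qed

lemma pmf_entropy_uniform:
  assumes "1 < b" and "finite Y" "Y \<noteq> {}" and "map_pmf X p = pmf_of_set Y"
  shows "pmf_entropy b p X = log b (card Y)"
proof -
  interpret information_space "measure_pmf p" b
    using assms(1) by unfold_locales auto
  let ?q = "pmf_of_set Y" and ?C = "count_space UNIV"
  have d: "distr (measure_pmf p) ?C X = measure_pmf ?q"
    using assms(4) by (metis map_pmf_rep_eq)
  have ex: "density ?C (\<lambda>x. ennreal (pmf ?q x)) = measure_pmf ?q"
    by (rule measure_pmf_eq_density[symmetric])
  \<comment> \<open>A count space on an uncountable type is not sigma-finite, so the Radon-Nikodym
    derivative is identified through singletons.\<close>
  have "density ?C (RN_deriv ?C ?q) = measure_pmf ?q"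
    by (rule RN_derivI[OF _ ex]) simp
  then have "emeasure (density ?C (RN_deriv ?C ?q)) {y} = ennreal (pmf ?q y)" for y
    by (simp add: emeasure_pmf_single)
  then have RN: "RN_deriv ?C ?q y = ennreal (pmf ?q y)" for y
    by (simp add: emeasure_density)
  have "KL_divergence b ?C ?q = (\<integral>x. log b (pmf ?q x) \<partial>measure_pmf ?q)"
    unfolding KL_divergence_def entropy_density_def by (simp add: RN comp_def)
  also have "\<dots> = (\<integral>x. log b (1 / card Y) \<partial>measure_pmf ?q)"
    using assms by (intro integral_cong_AE) (auto simp: AE_measure_pmf_iff)
  also have "\<dots> = - log b (card Y)"
    using assms by (simp add: log_divide card_gt_0_iff)
  finally show ?thesis
    unfolding pmf_entropy_def prob_space.entropy_def[OF measure_pmf.prob_space_axioms] d by simp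
qed

text \<open>Each \<open>t\<close> injects the fibre over \<open>y\<close> into the fibre over
  \<open>y'\<close>; applied in both directions, this makes all fibres equally large.\<close>

lemma map_pmf_of_set_fibers:
  assumes "finite \<Omega>" "\<Omega> \<noteq> {}" "h ` \<Omega> = Y"
    and tr: "\<And>y y'. y \<in> Y \<Longrightarrow> y' \<in> Y \<Longrightarrow>
      \<exists>t. inj_on t \<Omega> \<and> t ` \<Omega> \<subseteq> \<Omega> \<and> (\<forall>w\<in>\<Omega>. h w = y \<longrightarrow> h (t w) = y')"
  shows "map_pmf h (pmf_of_set \<Omega>) = pmf_of_set Y"
proof -
  have fin: "finite Y" "Y \<noteq> {}" using assms by auto
  define c where "c y = card {w\<in>\<Omega>. h w = y}" for y
  have le: "c y \<le> c y'" if yy: "y \<in> Y" "y' \<in> Y" for y y'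
  proof -
    obtain t where t: "inj_on t \<Omega>" "t ` \<Omega> \<subseteq> \<Omega>" "\<forall>w\<in>\<Omega>. h w = y \<longrightarrow> h (t w) = y'"
      using tr[OF yy] by blast
    show ?thesis unfolding c_def
      by (rule card_inj_on_le[where f = t]) (use t assms(1) in \<open>auto intro: inj_on_subset\<close>)
  qed
  obtain y0 where y0: "y0 \<in> Y" using fin by auto
  have cc: "c y = c y0" if "y \<in> Y" for y using le y0 that by (meson le_antisym)
  have "card \<Omega> = (\<Sum>y\<in>Y. c y)"
    unfolding c_def using sum.group[OF assms(1) fin(1), of h "\<lambda>_. 1::nat"] assms(3)
    by simp
  then have tot: "card \<Omega> = card Y * c y0" by (simp add: cc)
  have pos: "card \<Omega> > 0" using assms by (simp add: card_gt_0_iff)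
  show ?thesis
  proof (rule pmf_eqI)
    fix y
    have "pmf (map_pmf h (pmf_of_set \<Omega>)) y = card (\<Omega> \<inter> h -` {y}) / card \<Omega>"
      using assms by (simp add: pmf_map measure_pmf_of_set)
    also have "\<Omega> \<inter> h -` {y} = {w\<in>\<Omega>. h w = y}" by auto
    also have "real (card {w\<in>\<Omega>. h w = y}) / card \<Omega> = pmf (pmf_of_set Y) y"
    proof (cases "y \<in> Y")
      case True
      then show ?thesis using tot pos fin cc[OF True] by (simp add: c_def[symmetric] field_simps)
    next
      case False
      then have "{w\<in>\<Omega>. h w = y} = {}" using assms(3) by auto
      with False fin show ?thesis by (simp only: card.empty) simp
    qed
    finally show "pmf (map_pmf h (pmf_of_set \<Omega>)) y = pmf (pmf_of_set Y) y" .
  qed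
qed

section \<open>Linear algebra over a finite field\<close>

context field
begin

lemma finsum_swap:
  assumes "finite A" "finite C" "\<And>x y. x \<in> A \<Longrightarrow> y \<in> C \<Longrightarrow> f x y \<in> carrier R"
  shows "(\<Oplus>x\<in>A. \<Oplus>y\<in>C. f x y) = (\<Oplus>y\<in>C. \<Oplus>x\<in>A. f x y)"
  using assms(1,3)
proof (induction A rule: finite_induct)
  case (insert a A)
  then have "(\<Oplus>x\<in>insert a A. \<Oplus>y\<in>C. f x y) = (\<Oplus>y\<in>C. f a y) \<oplus> (\<Oplus>y\<in>C. \<Oplus>x\<in>A. f x y)"
    by (subst finsum_insert) (auto intro!: finsum_closed)
  also have "\<dots> = (\<Oplus>y\<in>C. f a y \<oplus> (\<Oplus>x\<in>A. f x y))"
    using insert by (intro finsum_addf[symmetric]) (auto intro!: finsum_closed)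
  also have "\<dots> = (\<Oplus>y\<in>C. \<Oplus>x\<in>insert a A. f x y)"
    using insert by (intro finsum_cong') (auto intro!: finsum_closed)
  finally show ?case .
qed (simp add: finsum_zero)

section \<open>Inner products and linearly independent families\<close>

definition dot :: "'i set \<Rightarrow> ('i \<Rightarrow> 'a) \<Rightarrow> ('i \<Rightarrow> 'a) \<Rightarrow> 'a" where
  "dot I x y = (\<Oplus>i\<in>I. x i \<otimes> y i)"

text \<open>\<open>I\<close> numbers the entries of a vector and \<open>J\<close> the vectors. It is
  a family that is independent, not a set: equal vectors at two indices count as dependent.\<close>

definition indep :: "'i set \<Rightarrow> 'j set \<Rightarrow> ('j \<Rightarrow> 'i \<Rightarrow> 'a) \<Rightarrow> bool" where
  "indep I J v \<longleftrightarrow> (\<forall>c\<in>J \<rightarrow> carrier R. (\<forall>i\<in>I. dot J c (\<lambda>j. v j i) = \<zero>) \<longrightarrow> (\<forall>j\<in>J. c j = \<zero>))"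

lemma dot_closed [simp, intro]:
  "x \<in> I \<rightarrow> carrier R \<Longrightarrow> y \<in> I \<rightarrow> carrier R \<Longrightarrow> dot I x y \<in> carrier R"
  unfolding dot_def by (auto intro!: finsum_closed simp: Pi_iff)

lemma dot_cong:
  assumes "\<And>i. i \<in> I \<Longrightarrow> x i = x' i" "\<And>i. i \<in> I \<Longrightarrow> y i = y' i"
    and "x' \<in> I \<rightarrow> carrier R" "y' \<in> I \<rightarrow> carrier R"
  shows "dot I x y = dot I x' y'"
  unfolding dot_def using assms by (intro finsum_cong') (auto simp: Pi_iff)

lemma dot_add_right:
  assumes "x \<in> I \<rightarrow> carrier R" "y \<in> I \<rightarrow> carrier R" "z \<in> I \<rightarrow> carrier R"
  shows "dot I x (\<lambda>i. y i \<oplus> z i) = dot I x y \<oplus> dot I x z"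
proof -
  have "dot I x (\<lambda>i. y i \<oplus> z i) = (\<Oplus>i\<in>I. x i \<otimes> y i \<oplus> x i \<otimes> z i)"
    unfolding dot_def using assms by (intro finsum_cong') (auto simp: Pi_iff r_distr)
  also have "\<dots> = dot I x y \<oplus> dot I x z"
    unfolding dot_def using assms by (intro finsum_addf) (auto simp: Pi_iff)
  finally show ?thesis .
qed

lemma dot_scale_right:
  assumes "x \<in> I \<rightarrow> carrier R" "y \<in> I \<rightarrow> carrier R" "a \<in> carrier R"
  shows "dot I x (\<lambda>i. a \<otimes> y i) = a \<otimes> dot I x y"
proof (cases "finite I")
  case True
  have "dot I x (\<lambda>i. a \<otimes> y i) = (\<Oplus>i\<in>I. a \<otimes> (x i \<otimes> y i))"
    unfolding dot_def using assms by (intro finsum_cong') (auto simp: Pi_iff m_lcomm)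
  also have "\<dots> = a \<otimes> dot I x y"
    unfolding dot_def using assms True by (intro finsum_rdistr[symmetric]) (auto simp: Pi_iff)
  finally show ?thesis .
qed (use assms in \<open>simp add: dot_def finsum_infinite\<close>)

lemma dot_commute:
  assumes "x \<in> I \<rightarrow> carrier R" "y \<in> I \<rightarrow> carrier R"
  shows "dot I x y = dot I y x"
  unfolding dot_def using assms by (intro finsum_cong') (auto simp: Pi_iff m_comm)

lemma dot_diff_right:
  assumes "x \<in> I \<rightarrow> carrier R" "y \<in> I \<rightarrow> carrier R" "z \<in> I \<rightarrow> carrier R"
  shows "dot I x (\<lambda>i. y i \<ominus> z i) = dot I x y \<ominus> dot I x z"
proof -
  have "dot I x y = dot I x (\<lambda>i. (y i \<ominus> z i) \<oplus> z i)"
    using assms by (intro dot_cong) (auto simp: Pi_iff minus_eq a_assoc l_neg)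
  also have "\<dots> = dot I x (\<lambda>i. y i \<ominus> z i) \<oplus> dot I x z"
    using assms by (intro dot_add_right) (auto simp: Pi_iff)
  finally show ?thesis using assms
    by (simp add: minus_eq a_assoc r_neg Pi_iff)
qed

lemma dot_zero_right: "x \<in> I \<rightarrow> carrier R \<Longrightarrow> (\<And>i. i \<in> I \<Longrightarrow> y i = \<zero>) \<Longrightarrow> dot I x y = \<zero>"
  unfolding dot_def by (subst finsum_cong'[where g = "\<lambda>_. \<zero>" and B = I]) (auto simp: Pi_iff finsum_zero)

text \<open>Associativity of row vector times matrix times column vector.\<close>

lemma dot_dot:
  assumes "finite I" "finite J" "c \<in> J \<rightarrow> carrier R" "v \<in> J \<rightarrow> I \<rightarrow> carrier R" "y \<in> I \<rightarrow> carrier R"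
  shows "dot I (\<lambda>i. dot J c (\<lambda>j. v j i)) y = dot J c (\<lambda>j. dot I (v j) y)"
proof -
  have "dot I (\<lambda>i. dot J c (\<lambda>j. v j i)) y = (\<Oplus>i\<in>I. \<Oplus>j\<in>J. (c j \<otimes> v j i) \<otimes> y i)"
    unfolding dot_def using assms
    by (intro finsum_cong' refl) (auto intro!: finsum_closed finsum_ldistr simp: Pi_iff)
  also have "\<dots> = (\<Oplus>j\<in>J. \<Oplus>i\<in>I. c j \<otimes> (v j i \<otimes> y i))"
    using assms by (subst finsum_swap) (auto intro!: finsum_cong' finsum_closed simp: Pi_iff m_assoc)
  also have "\<dots> = dot J c (\<lambda>j. dot I (v j) y)"
    unfolding dot_def using assms
    by (intro finsum_cong' refl) (auto intro!: finsum_closed finsum_rdistr[symmetric] simp: Pi_iff)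
  finally show ?thesis .
qed

lemma indepD:
  assumes "indep I J v" "c \<in> J \<rightarrow> carrier R" "\<And>i. i \<in> I \<Longrightarrow> dot J c (\<lambda>j. v j i) = \<zero>" "j \<in> J"
  shows "c j = \<zero>"
  using assms unfolding indep_def by blast

lemma dot_left_inj:
  assumes "indep I J v" "v \<in> J \<rightarrow> I \<rightarrow> carrier R" "c \<in> J \<rightarrow> carrier R" "c' \<in> J \<rightarrow> carrier R"
    and "\<And>i. i \<in> I \<Longrightarrow> dot J c (\<lambda>j. v j i) = dot J c' (\<lambda>j. v j i)" "j \<in> J"
  shows "c j = c' j"
proof -
  have "dot J (\<lambda>j. c j \<ominus> c' j) (\<lambda>j. v j i) = \<zero>" if "i \<in> I" for i
  proof -
    have "dot J (\<lambda>j. c j \<ominus> c' j) (\<lambda>j. v j i) = dot J (\<lambda>j. v j i) (\<lambda>j. c j \<ominus> c' j)"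
      using assms that by (intro dot_commute) (auto simp: Pi_iff)
    also have "\<dots> = dot J c (\<lambda>j. v j i) \<ominus> dot J c' (\<lambda>j. v j i)"
      using assms that by (subst dot_diff_right) (auto simp: Pi_iff dot_commute)
    also have "\<dots> = \<zero>"
      using assms that by (simp add: Pi_iff minus_eq r_neg)
    finally show ?thesis .
  qed
  then have "c j \<ominus> c' j = \<zero>"
    using indepD[OF assms(1), of "\<lambda>j. c j \<ominus> c' j" j] assms(3,4,6) by (auto simp: Pi_iff)
  then show ?thesis using assms(3,4,6) by (simp add: Pi_iff)
qed

lemma indep_subset:
  assumes "indep I J v" "v \<in> J \<rightarrow> I \<rightarrow> carrier R" "J' \<subseteq> J" "finite J"
  shows "indep I J' v"
  unfolding indep_def
proof (intro ballI impI)
  fix c j assume c: "c \<in> J' \<rightarrow> carrier R" "\<forall>i\<in>I. dot J' c (\<lambda>j. v j i) = \<zero>" "j \<in> J'"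
  let ?c = "\<lambda>j. if j \<in> J' then c j else \<zero>"
  have *: "dot J ?c (\<lambda>j. v j i) = \<zero>" if "i \<in> I" for i
  proof -
    have "dot J ?c (\<lambda>j. v j i) = dot J' c (\<lambda>j. v j i)"
      unfolding dot_def using assms c that
      by (intro add.finprod_mono_neutral_cong_right) (auto simp: Pi_iff)
    then show ?thesis using c that by simp
  qed
  have "?c j = \<zero>"
    by (rule indepD[OF assms(1), of ?c]) (use assms c * in \<open>auto simp: Pi_iff\<close>)
  then show "c j = \<zero>" using c by simp
qed

lemma indep_cong:
  assumes "indep I J v" "v \<in> J \<rightarrow> I \<rightarrow> carrier R" "\<And>i j. i \<in> I \<Longrightarrow> j \<in> J \<Longrightarrow> w j i = v j i"
  shows "indep I J w"
  unfolding indep_def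
proof (intro ballI impI)
  fix c j assume c: "c \<in> J \<rightarrow> carrier R" "\<forall>i\<in>I. dot J c (\<lambda>j. w j i) = \<zero>" "j \<in> J"
  have "dot J c (\<lambda>j. v j i) = dot J c (\<lambda>j. w j i)" if "i \<in> I" for i
    using assms c that by (intro dot_cong) (auto simp: Pi_iff)
  then show "c j = \<zero>" using c indepD[OF assms(1), of c j] by auto
qed

lemma indep_reindex:
  assumes "indep I J v" "v \<in> J \<rightarrow> I \<rightarrow> carrier R" "bij_betw h A J"
  shows "indep I A (\<lambda>a. v (h a))"
  unfolding indep_def
proof (intro ballI impI)
  fix c a assume c: "c \<in> A \<rightarrow> carrier R" "\<forall>i\<in>I. dot A c (\<lambda>a. v (h a) i) = \<zero>" "a \<in> A"
  let ?g = "inv_into A h"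
  have h: "inj_on h A" "h ` A = J" using assms(3) by (auto simp: bij_betw_def)
  have gc: "(\<lambda>j. c (?g j)) \<in> J \<rightarrow> carrier R"
    using c h by (auto simp: inv_into_into)
  have "dot J (\<lambda>j. c (?g j)) (\<lambda>j. v j i) = \<zero>" if "i \<in> I" for i
  proof -
    have "dot J (\<lambda>j. c (?g j)) (\<lambda>j. v j i) = (\<Oplus>j\<in>h ` A. c (?g j) \<otimes> v j i)"
      by (simp add: dot_def h)
    also have "\<dots> = (\<Oplus>a\<in>A. c (?g (h a)) \<otimes> v (h a) i)"
      using gc assms(2) h that by (intro finsum_reindex) (auto simp: Pi_iff)
    also have "\<dots> = dot A c (\<lambda>a. v (h a) i)"
      unfolding dot_def using h c assms(2) that by (intro finsum_cong') (auto simp: Pi_iff)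
    finally show ?thesis using c that by simp
  qed
  then have "c (?g (h a)) = \<zero>"
    using c h indepD[OF assms(1) gc, of "h a"] by auto
  then show "c a = \<zero>" using h c by simp
qed

section \<open>Spanning, completion to a basis, Vandermonde families\<close>

text \<open>Sending coefficients to their combination is injective by independence and maps between
  finite sets of the same size, so it is onto.\<close>

lemma span_if_indep:
  assumes fin: "finite (carrier R)" "finite I" "finite J" "card J = card I"
    and v: "indep I J v" "v \<in> J \<rightarrow> I \<rightarrow> carrier R" and y: "y \<in> I \<rightarrow> carrier R"
  obtains c where "c \<in> J \<rightarrow> carrier R" "\<And>i. i \<in> I \<Longrightarrow> dot J c (\<lambda>j. v j i) = y i"
proof -
  let ?f = "\<lambda>c. \<lambda>i\<in>I. dot J c (\<lambda>j. v j i)"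
  have "inj_on ?f (J \<rightarrow>\<^sub>E carrier R)"
  proof (rule inj_onI)
    fix c c' assume c: "c \<in> J \<rightarrow>\<^sub>E carrier R" "c' \<in> J \<rightarrow>\<^sub>E carrier R" "?f c = ?f c'"
    have "dot J c (\<lambda>j. v j i) = dot J c' (\<lambda>j. v j i)" if "i \<in> I" for i
      using fun_cong[OF c(3), of i] that by simp
    then have "c j = c' j" if "j \<in> J" for j
      using dot_left_inj[OF v, of c c'] c that by auto
    then show "c = c'" using c by (intro PiE_ext) auto
  qed
  moreover have "?f ` (J \<rightarrow>\<^sub>E carrier R) \<subseteq> I \<rightarrow>\<^sub>E carrier R"
    using v(2) by (auto simp: Pi_iff intro!: dot_closed)
  moreover have "card (J \<rightarrow>\<^sub>E carrier R) = card (I \<rightarrow>\<^sub>E carrier R)"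
    using fin by (simp add: card_PiE)
  moreover have "finite (I \<rightarrow>\<^sub>E carrier R)"
    using fin by (simp add: finite_PiE)
  ultimately have "?f ` (J \<rightarrow>\<^sub>E carrier R) = I \<rightarrow>\<^sub>E carrier R"
    by (metis card_image card_subset_eq)
  moreover have "restrict y I \<in> I \<rightarrow>\<^sub>E carrier R" using y by auto
  ultimately obtain c where c: "c \<in> J \<rightarrow>\<^sub>E carrier R" "?f c = restrict y I"
    by (metis (no_types, lifting) imageE)
  have "dot J c (\<lambda>j. v j i) = y i" if "i \<in> I" for i
    using fun_cong[OF c(2), of i] that by (simp del: c(2))
  then show ?thesis using that c by blast
qed

text \<open>The \<open>v j\<close> span, so the unit vector at \<open>k\<close> is a combination of
  them and \<open>y k\<close> is a combination of vanishing products. Every decoding step below is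
  an instance of this.\<close>

lemma dot_eq_zero_imp_zero:
  assumes fin: "finite (carrier R)" "finite I" "finite J" "card J = card I"
    and v: "indep I J v" "v \<in> J \<rightarrow> I \<rightarrow> carrier R" and y: "y \<in> I \<rightarrow> carrier R"
    and z: "\<And>j. j \<in> J \<Longrightarrow> dot I (v j) y = \<zero>" and k: "k \<in> I"
  shows "y k = \<zero>"
proof -
  let ?e = "\<lambda>i. if i = k then \<one> else \<zero>"
  obtain c where c: "c \<in> J \<rightarrow> carrier R" "\<And>i. i \<in> I \<Longrightarrow> dot J c (\<lambda>j. v j i) = ?e i"
    using span_if_indep[OF fin v, of ?e] by auto
  have "y k = dot I ?e y"
  proof -
    have "dot I ?e y = (\<Oplus>i\<in>I. if k = i then y i else \<zero>)"
      unfolding dot_def using y k by (intro finsum_cong') (auto simp: Pi_iff)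
    also have "\<dots> = y k"
      using y fin k by (intro finsum_singleton) auto
    finally show ?thesis by simp
  qed
  also have "\<dots> = dot I (\<lambda>i. dot J c (\<lambda>j. v j i)) y"
    using c y by (intro dot_cong) auto
  also have "\<dots> = dot J c (\<lambda>j. dot I (v j) y)"
    using fin c v y by (intro dot_dot) auto
  also have "\<dots> = \<zero>" by (rule dot_zero_right) (use c z in auto)
  finally show ?thesis .
qed

text \<open>By counting: the combinations of fewer than \<open>card I\<close> vectors do not exhaust
  the space, and any \<open>w\<close> outside their span will do.\<close>

lemma indep_insert_exists:
  assumes fin: "finite (carrier R)" "finite I" "finite J" "card J < card I" "a \<notin> J"
    and v: "indep I J v" "v \<in> J \<rightarrow> I \<rightarrow> carrier R"
  obtains w where "w \<in> I \<rightarrow> carrier R" "indep I (insert a J) (v(a := w))"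
proof -
  let ?f = "\<lambda>c. \<lambda>i\<in>I. dot J c (\<lambda>j. v j i)"
  have one: "card (carrier R) > 1"
    using fin(1) one_not_zero zero_closed one_closed
    by (metis One_nat_def card_le_Suc0_iff_eq not_le)
  have "card (?f ` (J \<rightarrow>\<^sub>E carrier R)) \<le> card (J \<rightarrow>\<^sub>E carrier R)"
    using fin by (intro card_image_le finite_PiE) auto
  also have "\<dots> < card (I \<rightarrow>\<^sub>E carrier R)"
    using fin one by (simp add: card_PiE)
  finally have "\<not> (I \<rightarrow>\<^sub>E carrier R) \<subseteq> ?f ` (J \<rightarrow>\<^sub>E carrier R)"
    using fin by (metis card_mono finite_PiE finite_imageI not_le)
  then obtain w where w: "w \<in> I \<rightarrow>\<^sub>E carrier R" "w \<notin> ?f ` (J \<rightarrow>\<^sub>E carrier R)" by blast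
  have "indep I (insert a J) (v(a := w))"
    unfolding indep_def
  proof (intro ballI impI)
    fix c j assume c: "c \<in> insert a J \<rightarrow> carrier R"
      "\<forall>i\<in>I. dot (insert a J) c (\<lambda>j. (v(a := w)) j i) = \<zero>" and j: "j \<in> insert a J"
    have eq: "c a \<otimes> w i \<oplus> dot J c (\<lambda>j. v j i) = \<zero>" if "i \<in> I" for i
    proof -
      have "dot (insert a J) c (\<lambda>j. (v(a := w)) j i)
          = c a \<otimes> w i \<oplus> (\<Oplus>j\<in>J. c j \<otimes> (v(a := w)) j i)"
        unfolding dot_def using fin c w v that by (subst finsum_insert) (auto simp: Pi_iff)
      also have "(\<Oplus>j\<in>J. c j \<otimes> (v(a := w)) j i) = dot J c (\<lambda>j. v j i)"
        unfolding dot_def using fin c w v that by (intro finsum_cong') (auto simp: Pi_iff)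
      finally show ?thesis using c that by simp
    qed
    have a0: "c a = \<zero>"
    proof (rule ccontr)
      assume nz: "c a \<noteq> \<zero>"
      have ca: "c a \<in> Units R" "c a \<in> carrier R" using nz c field_Units by auto
      let ?s = "\<ominus> (inv (c a))"
      have s: "?s \<in> carrier R" using ca by simp
      have "w i = ?f (\<lambda>j\<in>J. ?s \<otimes> c j) i" if i: "i \<in> I" for i
      proof -
        let ?d = "dot J c (\<lambda>j. v j i)"
        have car: "w i \<in> carrier R" "?d \<in> carrier R" using w c v i by (auto intro!: dot_closed simp: Pi_iff)
        have "dot J (\<lambda>j\<in>J. ?s \<otimes> c j) (\<lambda>j. v j i) = dot J (\<lambda>j. v j i) (\<lambda>j. ?s \<otimes> c j)"
          using c v s i by (subst dot_commute) (auto simp: Pi_iff intro!: dot_cong)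
        also have "\<dots> = ?s \<otimes> dot J (\<lambda>j. v j i) c"
          using c v s i by (intro dot_scale_right) (auto simp: Pi_iff)
        also have "dot J (\<lambda>j. v j i) c = ?d"
          using c v i by (intro dot_commute) (auto simp: Pi_iff)
        also have "?d = \<ominus> (c a \<otimes> w i)"
          using eq[OF i] car ca by (metis add.m_comm m_closed minus_equality)
        also have "?s \<otimes> \<ominus> (c a \<otimes> w i) = inv (c a) \<otimes> (c a \<otimes> w i)"
          using ca car by (simp add: l_minus r_minus)
        also have "\<dots> = w i" using ca car by (simp add: m_assoc[symmetric])
        finally show ?thesis unfolding restrict_apply'[OF i] by (rule sym)
      qed
      then have "w = ?f (\<lambda>j\<in>J. ?s \<otimes> c j)" using w by (intro PiE_ext[of w I "\<lambda>_. UNIV"]) auto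
      moreover have "(\<lambda>j\<in>J. ?s \<otimes> c j) \<in> J \<rightarrow>\<^sub>E carrier R" using c s by auto
      ultimately show False using w(2) by blast
    qed
    show "c j = \<zero>"
    proof (cases "j = a")
      case False
      then have "j \<in> J" using j by simp
      moreover have "dot J c (\<lambda>j. v j i) = \<zero>" if "i \<in> I" for i
      proof -
        have "w i \<in> carrier R" "dot J c (\<lambda>j. v j i) \<in> carrier R"
          using w c v that by (auto intro!: dot_closed simp: Pi_iff)
        then show ?thesis using eq[OF that] a0 by simp
      qed
      ultimately show ?thesis using c indepD[OF v(1), of c j] by auto
    qed (use a0 in simp)
  qed
  then show ?thesis using that w by blast
qed

lemma indep_extend:
  assumes fin: "finite (carrier R)" "finite I" "finite J'" "card J' \<le> card I" "J \<subseteq> J'"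
    and v: "indep I J v" "v \<in> J \<rightarrow> I \<rightarrow> carrier R"
  obtains w where "w \<in> J' \<rightarrow> I \<rightarrow> carrier R" "indep I J' w" "\<And>j. j \<in> J \<Longrightarrow> w j = v j"
proof -
  have "\<exists>w. w \<in> J \<union> E \<rightarrow> I \<rightarrow> carrier R \<and> indep I (J \<union> E) w \<and> (\<forall>j\<in>J. w j = v j)"
    if "finite E" "E \<subseteq> J' - J" for E using that
  proof (induction E rule: finite_induct)
    case (insert a E)
    then obtain w where w: "w \<in> J \<union> E \<rightarrow> I \<rightarrow> carrier R" "indep I (J \<union> E) w" "\<forall>j\<in>J. w j = v j"
      by auto
    have a: "a \<notin> J \<union> E" using insert by auto
    have "card (J \<union> E) < card J'"
      using insert fin a by (intro psubset_card_mono) auto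
    then have "card (J \<union> E) < card I" using fin by simp
    moreover have "finite (J \<union> E)" using insert fin by (meson finite_Un finite_subset)
    ultimately obtain u where u: "u \<in> I \<rightarrow> carrier R" "indep I (insert a (J \<union> E)) (w(a := u))"
      using indep_insert_exists[OF fin(1,2) _ _ a w(2,1)] by blast
    have "w(a := u) \<in> insert a (J \<union> E) \<rightarrow> I \<rightarrow> carrier R"
      using w(1) u(1) by (simp add: Pi_iff)
    moreover have "\<forall>j\<in>J. (w(a := u)) j = v j" using w(3) a by auto
    ultimately show ?case using u(2) unfolding Un_insert_right by blast
  next
    case empty
    then show ?case using v by (intro exI[of _ v]) simp
  qed
  from this[of "J' - J"] obtain w where
    "w \<in> J' \<rightarrow> I \<rightarrow> carrier R \<and> indep I J' w \<and> (\<forall>j\<in>J. w j = v j)"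
    using fin by (auto simp: Un_absorb1)
  then show ?thesis using that by blast
qed

text \<open>Completion to an invertible matrix with prescribed row positions \<sigma>. Privacy needs
  the positions to be fixed before the vectors, because the vectors depend on the wanted
  file.\<close>

lemma indep_embed:
  assumes fin: "finite (carrier R)" "finite I" "finite I'" "card I' = card I"
    and \<sigma>: "inj_on \<sigma> J" "\<sigma> ` J \<subseteq> I'"
    and v: "indep I J v" "v \<in> J \<rightarrow> I \<rightarrow> carrier R"
  obtains w where "w \<in> I' \<rightarrow> I \<rightarrow> carrier R" "indep I I' w" "\<And>j. j \<in> J \<Longrightarrow> w (\<sigma> j) = v j"
proof -
  let ?g = "inv_into J \<sigma>"
  have "indep I (\<sigma> ` J) (\<lambda>l. v (?g l))"
    by (rule indep_reindex[OF v]) (use \<sigma> in \<open>simp add: bij_betw_inv_into bij_betw_def inj_on_inv_into\<close>)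
  moreover have "(\<lambda>l. v (?g l)) \<in> \<sigma> ` J \<rightarrow> I \<rightarrow> carrier R"
    using v \<sigma> by (auto simp: Pi_iff)
  ultimately obtain w where w: "w \<in> I' \<rightarrow> I \<rightarrow> carrier R" "indep I I' w"
     "\<And>l. l \<in> \<sigma> ` J \<Longrightarrow> w l = v (?g l)"
    using indep_extend[of I I' "\<sigma> ` J" "\<lambda>l. v (?g l)"] fin \<sigma> by auto
  show ?thesis
    by (rule that[of w]) (use w \<sigma> in auto)
qed

lemma dot_prescribe:
  assumes fin: "finite (carrier R)" "finite I" "finite J" "card J \<le> card I"
    and v: "indep I J v" "v \<in> J \<rightarrow> I \<rightarrow> carrier R" and z: "z \<in> J \<rightarrow> carrier R"
  obtains y where "y \<in> I \<rightarrow> carrier R" "\<And>j. j \<in> J \<Longrightarrow> dot I (v j) y = z j"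
proof -
  obtain \<sigma> where \<sigma>: "inj_on \<sigma> J" "\<sigma> ` J \<subseteq> I"
    using card_le_inj[OF fin(3,2,4)] by blast
  obtain w where w: "w \<in> I \<rightarrow> I \<rightarrow> carrier R" "indep I I w" "\<And>j. j \<in> J \<Longrightarrow> w (\<sigma> j) = v j"
    using indep_embed[OF fin(1,2,2) refl \<sigma> v] by blast
  \<comment> \<open>The transpose of the completed matrix is invertible as well: a relation between
    its rows is a vector orthogonal to every \<open>w i\<close>. Hence the values \<open>z\<close>,
    padded by zeros, lie in the span of those rows.\<close>
  have ind: "indep I I (\<lambda>i k. w k i)"
    unfolding indep_def
  proof (intro ballI impI)
    fix c j assume c: "c \<in> I \<rightarrow> carrier R" "\<forall>i\<in>I. dot I c (\<lambda>j. w i j) = \<zero>" "j \<in> I"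
    show "c j = \<zero>"
      by (rule dot_eq_zero_imp_zero[OF fin(1,2,2) refl w(2,1) c(1) _ c(3)])
        (use c w in \<open>auto simp: dot_commute Pi_iff\<close>)
  qed
  have cl: "(\<lambda>i k. w k i) \<in> I \<rightarrow> I \<rightarrow> carrier R" using w by (auto simp: Pi_iff)
  let ?z = "\<lambda>l. if l \<in> \<sigma> ` J then z (inv_into J \<sigma> l) else \<zero>"
  have z': "?z \<in> I \<rightarrow> carrier R" using z by (auto simp: Pi_iff inv_into_into)
  obtain y where y: "y \<in> I \<rightarrow> carrier R" "\<And>i. i \<in> I \<Longrightarrow> dot I y (w i) = ?z i"
    by (rule span_if_indep[OF fin(1,2,2) refl ind cl z']) blast
  have "dot I (v j) y = z j" if "j \<in> J" for j
  proof -
    have "dot I (v j) y = dot I y (w (\<sigma> j))"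
      using w y v that by (subst dot_commute) (auto simp: Pi_iff)
    then show ?thesis using y(2)[of "\<sigma> j"] that \<sigma> by auto
  qed
  then show ?thesis using that y by blast
qed

lemma vandermonde_indep:
  assumes "finite J" "x \<in> J \<rightarrow> carrier R" "inj_on x J" "card J \<le> d"
  shows "indep {..<d} J (\<lambda>p j. x p [^] j)"
  unfolding indep_def
proof (intro ballI impI)
  fix c p assume "c \<in> J \<rightarrow> carrier R" "\<forall>i\<in>{..<d}. dot J c (\<lambda>j. x j [^] i) = \<zero>" "p \<in> J"
  with assms show "c p = \<zero>"
  proof (induction J arbitrary: c d p rule: finite_induct)
    case (insert a J)
    then obtain d' where d: "d = Suc d'" by (cases d) auto
    have car: "x a \<in> carrier R" "c a \<in> carrier R" "\<And>p. p \<in> J \<Longrightarrow> x p \<in> carrier R"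
      "\<And>p. p \<in> J \<Longrightarrow> c p \<in> carrier R" using insert.prems by auto
    \<comment> \<open>Weighting by the distance to \<open>x a\<close> removes the point
      \<open>a\<close> and lowers the number of available powers by one.\<close>
    let ?c = "\<lambda>p. c p \<otimes> (x p \<ominus> x a)"
    have ins: "dot (insert a J) c (\<lambda>j. x j [^] i) = c a \<otimes> x a [^] i \<oplus> dot J c (\<lambda>j. x j [^] i)" for i :: nat
      unfolding dot_def using insert.hyps car by (intro finsum_insert) auto
    have 0: "c a \<otimes> x a [^] i \<oplus> dot J c (\<lambda>j. x j [^] i) = \<zero>" if "i < d" for i
      using insert.prems that ins by auto
    have "dot J ?c (\<lambda>j. x j [^] i) = \<zero>" if i: "i < d'" for i
    proof -
      let ?A = "\<lambda>i::nat. dot J c (\<lambda>j. x j [^] i)"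
      have A: "?A i \<in> carrier R" for i using car by (intro dot_closed) auto
      have "dot J ?c (\<lambda>j. x j [^] i) = dot J c (\<lambda>j. x j [^] Suc i \<ominus> x a \<otimes> x j [^] i)"
        unfolding dot_def
      proof (intro finsum_cong' refl)
        fix p assume p: "p \<in> J"
        have "c p \<otimes> (x p \<ominus> x a) \<otimes> x p [^] i = c p \<otimes> ((x p \<ominus> x a) \<otimes> x p [^] i)"
          using car p by (simp add: m_assoc)
        also have "(x p \<ominus> x a) \<otimes> x p [^] i = x p [^] Suc i \<ominus> x a \<otimes> x p [^] i"
          using car p by (simp add: minus_eq l_distr l_minus) (simp add: m_comm)
        finally show "c p \<otimes> (x p \<ominus> x a) \<otimes> x p [^] i = c p \<otimes> (x p [^] Suc i \<ominus> x a \<otimes> x p [^] i)" .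
      qed (use car in auto)
      also have "\<dots> = ?A (Suc i) \<ominus> dot J c (\<lambda>j. x a \<otimes> x j [^] i)"
        using car by (intro dot_diff_right) auto
      also have "dot J c (\<lambda>j. x a \<otimes> x j [^] i) = x a \<otimes> ?A i"
        using car by (intro dot_scale_right) auto
      also have "?A (Suc i) = \<ominus> (c a \<otimes> x a [^] Suc i)"
        using 0[of "Suc i"] i d car A by (intro sum_zero_eq_neg) (auto simp: a_comm)
      also have "?A i = \<ominus> (c a \<otimes> x a [^] i)"
        using 0[of i] i d car A by (intro sum_zero_eq_neg) (auto simp: a_comm)
      also have "x a \<otimes> \<ominus> (c a \<otimes> x a [^] i) = \<ominus> (c a \<otimes> x a [^] Suc i)"
        using car by (simp add: r_minus m_lcomm m_comm)
      finally show ?thesis using car by (simp add: minus_eq l_neg)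
    qed
    then have cJ: "?c p = \<zero>" if "p \<in> J" for p
      using insert.IH[of d' ?c p] insert.prems insert.hyps that car d by auto
    have cz: "c p = \<zero>" if "p \<in> J" for p
    proof -
      have "x p \<noteq> x a" using insert that by (auto simp: inj_on_def)
      then have "x p \<ominus> x a \<noteq> \<zero>" using car that by (metis r_right_minus_eq)
      then show ?thesis using cJ[OF that] car that integral[of "c p" "x p \<ominus> x a"] by auto
    qed
    have "dot J c (\<lambda>j. x j [^] (0::nat)) = dot J (\<lambda>j. x j [^] (0::nat)) c"
      using car by (intro dot_commute) auto
    also have "\<dots> = \<zero>" using cz car by (intro dot_zero_right) auto
    finally have "c a = \<zero>" using 0[of 0] car d by simp
    then show ?case using cz insert.prems by auto
  qed simp
qed

subsection \<open>Uniformly random invertible matrices\<close>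

definition gl :: "nat \<Rightarrow> (nat \<Rightarrow> nat \<Rightarrow> 'a) set" where
  "gl L = {U \<in> {..<L} \<rightarrow>\<^sub>E ({..<L} \<rightarrow>\<^sub>E carrier R). indep {..<L} {..<L} U}"

definition act :: "nat \<Rightarrow> (nat \<Rightarrow> 'a) \<Rightarrow> (nat \<Rightarrow> nat \<Rightarrow> 'a) \<Rightarrow> nat \<Rightarrow> 'a" where
  "act L x U = (\<lambda>l\<in>{..<L}. dot {..<L} x (\<lambda>j. U j l))"

lemma gl_carrier:
  assumes "U \<in> gl L"
  shows "U \<in> {..<L} \<rightarrow> {..<L} \<rightarrow> carrier R" "U \<in> {..<L} \<rightarrow>\<^sub>E ({..<L} \<rightarrow>\<^sub>E carrier R)"
    "indep {..<L} {..<L} U"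
  using assms by (auto simp: gl_def)

lemma act_closed:
  assumes "U \<in> gl L" "x \<in> {..<L} \<rightarrow> carrier R"
  shows "act L x U \<in> {..<L} \<rightarrow>\<^sub>E carrier R"
  using gl_carrier(1)[OF assms(1)] assms(2) by (auto simp: act_def intro!: dot_closed)

lemma finite_gl: "finite (carrier R) \<Longrightarrow> finite (gl L)"
  unfolding gl_def by (intro finite_subset[OF Collect_restrict] finite_PiE) auto

lemma gl_nonempty:
  assumes "finite (carrier R)"
  shows "gl L \<noteq> {}"
proof -
  have "indep {..<L} {} (\<lambda>_ _. \<zero>)" by (simp add: indep_def)
  then obtain w where w: "w \<in> {..<L} \<rightarrow> {..<L} \<rightarrow> carrier R" "indep {..<L} {..<L} w"
    using indep_extend[OF assms, of "{..<L}" "{..<L}" "{}" "\<lambda>_ _. \<zero>"] by auto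
  then have "indep {..<L} {..<L} (\<lambda>j\<in>{..<L}. \<lambda>l\<in>{..<L}. w j l)"
    by (intro indep_cong[OF w(2,1)]) auto
  moreover have "(\<lambda>j\<in>{..<L}. \<lambda>l\<in>{..<L}. w j l) \<in> {..<L} \<rightarrow>\<^sub>E ({..<L} \<rightarrow>\<^sub>E carrier R)"
    using w(1) by (intro restrict_PiE_iff[THEN iffD2] ballI) (auto simp: Pi_iff)
  ultimately show ?thesis unfolding gl_def by blast
qed

text \<open>A relation between the images says that some combination of the \<open>v j\<close> is
  annihilated by \<open>U\<close>; the rows of \<open>U\<close> are independent, so this combination
  is zero.\<close>

lemma indep_act:
  assumes U: "U \<in> gl L" and v: "indep {..<L} J v" "v \<in> J \<rightarrow> {..<L} \<rightarrow> carrier R" "finite J"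
  shows "indep {..<L} J (\<lambda>j. act L (v j) U)"
  unfolding indep_def
proof (intro ballI impI)
  fix c j assume c: "c \<in> J \<rightarrow> carrier R" and z: "\<forall>l\<in>{..<L}. dot J c (\<lambda>j. act L (v j) U l) = \<zero>"
    and j: "j \<in> J"
  note Uc = gl_carrier[OF U]
  let ?x = "\<lambda>k. dot J c (\<lambda>j. v j k)"
  have xc: "?x \<in> {..<L} \<rightarrow> carrier R"
    using c v(2) by (auto intro!: dot_closed simp: Pi_iff)
  have "dot {..<L} ?x (\<lambda>k. U k l) = \<zero>" if l: "l \<in> {..<L}" for l
  proof -
    have "dot {..<L} ?x (\<lambda>k. U k l) = dot J c (\<lambda>j. dot {..<L} (v j) (\<lambda>k. U k l))"
      using c v Uc(1) l by (intro dot_dot) (auto simp: Pi_iff)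
    also have "\<dots> = dot J c (\<lambda>j. act L (v j) U l)"
      using l by (simp add: act_def)
    finally show ?thesis using z l by simp
  qed
  then have "?x k = \<zero>" if "k \<in> {..<L}" for k
    using indepD[OF Uc(3) xc _ that] by blast
  then show "c j = \<zero>" using indepD[OF v(1) c _ j] by blast
qed

text \<open>The columns of \<open>U\<close> can be recovered from those of the product because
  \<open>Q\<close> is invertible; surjectivity follows from finiteness.\<close>

lemma gl_left_mult_bij:
  assumes fin: "finite (carrier R)"
    and Q: "Q \<in> {..<L} \<rightarrow> {..<L} \<rightarrow> carrier R" "indep {..<L} {..<L} Q"
  shows "bij_betw (\<lambda>U. \<lambda>j\<in>{..<L}. act L (Q j) U) (gl L) (gl L)"
proof -
  let ?f = "\<lambda>U. \<lambda>j\<in>{..<L}. act L (Q j) U"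
  have maps: "?f ` gl L \<subseteq> gl L"
  proof
    fix V assume "V \<in> ?f ` gl L"
    then obtain U where U: "U \<in> gl L" and V: "V = ?f U" by auto
    have cl: "(\<lambda>j. act L (Q j) U) \<in> {..<L} \<rightarrow> {..<L} \<rightarrow>\<^sub>E carrier R"
      using act_closed[OF U] Q(1) by (auto simp del: PiE_iff)
    have "indep {..<L} {..<L} V"
      unfolding V using cl
      by (intro indep_cong[OF indep_act[OF U Q(2,1)]]) (auto simp: PiE_iff Pi_iff)
    then show "V \<in> gl L" unfolding gl_def V using cl by auto
  qed
  have "inj_on ?f (gl L)"
  proof (rule inj_onI)
    fix U U' assume U: "U \<in> gl L" "U' \<in> gl L" and eq: "?f U = ?f U'"
    note c = gl_carrier[OF U(1)] gl_carrier[OF U(2)]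
    have "U k l = U' k l" if k: "k < L" and l: "l < L" for k l
    proof -
      let ?y = "\<lambda>k. U k l \<ominus> U' k l"
      have "?y k = \<zero>"
      proof (rule dot_eq_zero_imp_zero[OF fin finite_lessThan finite_lessThan refl Q(2,1), where y = ?y])
        fix j assume j: "j \<in> {..<L}"
        have "act L (Q j) U l = act L (Q j) U' l"
          using fun_cong[OF eq, of j] j by simp
        then have "dot {..<L} (Q j) (\<lambda>k. U k l) = dot {..<L} (Q j) (\<lambda>k. U' k l)"
          using l by (simp add: act_def)
        moreover have "dot {..<L} (Q j) (\<lambda>k. U k l) \<in> carrier R"
          using Q(1) c(1) j l by (auto intro!: dot_closed simp: Pi_iff)
        ultimately show "dot {..<L} (Q j) ?y = \<zero>"
          using Q(1) c(1,4) j l by (subst dot_diff_right) (auto simp: Pi_iff)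
      qed (use c(1,4) k l in \<open>auto simp: Pi_iff\<close>)
      then show ?thesis using c(1,4) k l by (simp add: Pi_iff)
    qed
    then show "U = U'"
      using c(2,5) by (intro PiE_ext[OF c(2,5)] PiE_ext[of _ "{..<L}" "\<lambda>_. carrier R"]) auto
  qed
  then show ?thesis
    using endo_inj_surj[OF finite_gl[OF fin] maps] by (simp add: bij_betw_def)
qed

text \<open>Left multiplication by an invertible matrix permutes the invertible matrices. Hence, for
  uniformly distributed \<open>U\<close>, an independent family of combinations of the rows of \<open>U\<close> is
  distributed as if it consisted of rows of \<open>U\<close>, whichever independent coefficients are used.\<close>

lemma gl_tuple_view_bij:
  fixes v :: "nat \<Rightarrow> 'p \<Rightarrow> nat \<Rightarrow> 'a"
  assumes fin: "finite (carrier R)"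
    and \<sigma>: "\<And>m. m < M \<Longrightarrow> inj_on (\<sigma> m) (J m)" "\<And>m. m < M \<Longrightarrow> \<sigma> m ` J m \<subseteq> {..<L}"
    and v: "\<And>m. m < M \<Longrightarrow> indep {..<L} (J m) (v m)"
      "\<And>m. m < M \<Longrightarrow> v m \<in> J m \<rightarrow> {..<L} \<rightarrow> carrier R"
  obtains \<tau> where "bij_betw \<tau> ({..<M} \<rightarrow>\<^sub>E gl L) ({..<M} \<rightarrow>\<^sub>E gl L)"
    "\<And>U m p. U \<in> {..<M} \<rightarrow>\<^sub>E gl L \<Longrightarrow> m < M \<Longrightarrow> p \<in> J m \<Longrightarrow> act L (v m p) (U m) = \<tau> U m (\<sigma> m p)"
proof -
  \<comment> \<open>\<open>Q m\<close> has \<open>v m p\<close> as its row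
    \<open>\<sigma> m p\<close>, so the observed combination is that row of the product of
    \<open>Q m\<close> and \<open>U m\<close>.\<close>
  have "\<exists>w. w \<in> {..<L} \<rightarrow> {..<L} \<rightarrow> carrier R \<and> indep {..<L} {..<L} w \<and> (\<forall>p\<in>J m. w (\<sigma> m p) = v m p)"
    if "m < M" for m
    using indep_embed[OF fin finite_lessThan finite_lessThan refl \<sigma>[OF that] v[OF that]] by metis
  then obtain Q where Q: "\<And>m. m < M \<Longrightarrow> Q m \<in> {..<L} \<rightarrow> {..<L} \<rightarrow> carrier R"
      "\<And>m. m < M \<Longrightarrow> indep {..<L} {..<L} (Q m)"
      "\<And>m p. m < M \<Longrightarrow> p \<in> J m \<Longrightarrow> Q m (\<sigma> m p) = v m p"
    by metis
  let ?f = "\<lambda>m U. \<lambda>j\<in>{..<L}. act L (Q m j) U"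
  let ?\<tau> = "\<lambda>U. \<lambda>m\<in>{..<M}. ?f m (U m)"
  have f: "bij_betw (?f m) (gl L) (gl L)" if "m < M" for m
    by (rule gl_left_mult_bij[OF fin Q(1,2)[OF that]])
  have maps: "?\<tau> ` ({..<M} \<rightarrow>\<^sub>E gl L) \<subseteq> {..<M} \<rightarrow>\<^sub>E gl L"
  proof
    fix V assume "V \<in> ?\<tau> ` ({..<M} \<rightarrow>\<^sub>E gl L)"
    then obtain U where U: "U \<in> {..<M} \<rightarrow>\<^sub>E gl L" and V: "V = ?\<tau> U" by (rule imageE)
    have "?f m (U m) \<in> gl L" if "m < M" for m
      using U that by (intro bij_betwE[OF f, rule_format]) auto
    then show "V \<in> {..<M} \<rightarrow>\<^sub>E gl L"
      unfolding V by (intro restrict_PiE_iff[THEN iffD2] ballI) (simp del: restrict_apply)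
  qed
  have "inj_on ?\<tau> ({..<M} \<rightarrow>\<^sub>E gl L)"
  proof (rule inj_onI)
    fix U U' assume U: "U \<in> {..<M} \<rightarrow>\<^sub>E gl L" "U' \<in> {..<M} \<rightarrow>\<^sub>E gl L" and eq: "?\<tau> U = ?\<tau> U'"
    show "U = U'"
    proof (rule PiE_ext[OF U])
      fix m assume m: "m \<in> {..<M}"
      have "?f m (U m) = ?f m (U' m)"
        using fun_cong[OF eq, of m] unfolding restrict_apply'[OF m] .
      then show "U m = U' m"
        using bij_betw_imp_inj_on[OF f[of m]] U m by (auto dest!: inj_onD simp del: restrict_apply)
    qed
  qed
  moreover have "finite ({..<M} \<rightarrow>\<^sub>E gl L)"
    using finite_gl[OF fin] by (intro finite_PiE) auto
  ultimately have "bij_betw ?\<tau> ({..<M} \<rightarrow>\<^sub>E gl L) ({..<M} \<rightarrow>\<^sub>E gl L)"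
    using endo_inj_surj[OF _ maps] by (simp add: bij_betw_def)
  moreover have "act L (v m p) (U m) = ?\<tau> U m (\<sigma> m p)" if "m < M" "p \<in> J m" for U m p
  proof -
    have "\<sigma> m p < L" using \<sigma>(2)[of m] that by auto
    then show ?thesis using Q(3)[OF that] that by simp
  qed
  ultimately show ?thesis by (rule that)
qed

end

section \<open>The scheme\<close>

text \<open>
  \<open>X\<close> is the set of coordinates, \<open>files p\<close> the set of files added up in the coordinate \<open>p\<close>, \<open>srv p\<close> its
  \<open>K\<close>-set of servers and \<open>pt p\<close> its Reed-Solomon evaluation point. The interference of the files in \<open>\<Gamma>\<close> is
  encoded with dimension \<open>d \<Gamma>\<close>. If \<open>i\<close> is wanted and \<open>\<gamma> i m l = (\<Gamma>, j)\<close> with nonempty \<open>\<Gamma>\<close>, then row \<open>l\<close> of the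
  random matrix of file \<open>m\<close> is the \<open>j\<close>-th message symbol of that code; rows with empty \<open>\<Gamma>\<close> are unused.
\<close>

locale pir_design = field F
  for F :: "'a ring" (structure) +
  fixes N K T M B L :: nat and G :: "nat \<Rightarrow> nat \<Rightarrow> 'a"
    and X :: "'x set" and files :: "'x \<Rightarrow> nat set" and srv :: "'x \<Rightarrow> nat set" and pt :: "'x \<Rightarrow> 'a"
    and d :: "nat set \<Rightarrow> nat" and \<gamma> :: "nat \<Rightarrow> nat \<Rightarrow> nat \<Rightarrow> nat set \<times> nat"
  assumes finF: "finite (carrier F)" and mds: "mds_matrix F N K G" and K: "1 \<le> K" "K \<le> N"
    and T: "1 \<le> T" "T \<le> N"
    and finX: "finite X"
    and files: "\<And>p. p \<in> X \<Longrightarrow> files p \<subseteq> {..<M}" "\<And>p. p \<in> X \<Longrightarrow> files p \<noteq> {}"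
    and srv: "\<And>p. p \<in> X \<Longrightarrow> srv p \<subseteq> {..<N}" "\<And>p. p \<in> X \<Longrightarrow> card (srv p) = K"
    and pt: "pt \<in> X \<rightarrow> carrier F" "inj_on pt X"
    and \<gamma>: "\<And>i m \<Gamma>. i < M \<Longrightarrow> m \<noteq> i \<Longrightarrow> m \<in> \<Gamma> \<Longrightarrow> \<Gamma> \<subseteq> {..<M} - {i} \<Longrightarrow>
       bij_betw (\<lambda>l. snd (\<gamma> i m l)) {l. l < L \<and> fst (\<gamma> i m l) = \<Gamma>} {..<d \<Gamma>}"
    and priv_wanted: "\<And>C i. C \<subseteq> {..<N} \<Longrightarrow> card C = T \<Longrightarrow> i < M \<Longrightarrow>
       card {p\<in>X. i \<in> files p \<and> srv p \<inter> C \<noteq> {}} \<le> L"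
    and priv_unwanted: "\<And>C i \<Gamma>. C \<subseteq> {..<N} \<Longrightarrow> card C = T \<Longrightarrow> i < M \<Longrightarrow>
       \<Gamma> \<noteq> {} \<Longrightarrow> \<Gamma> \<subseteq> {..<M} - {i} \<Longrightarrow> card {p\<in>X. files p - {i} = \<Gamma> \<and> srv p \<inter> C \<noteq> {}} \<le> d \<Gamma>"
    and corr_wanted: "\<And>C C' i. C \<subseteq> {..<N} \<Longrightarrow> C' \<subseteq> {..<N} \<Longrightarrow> card C = B \<Longrightarrow> card C' = B \<Longrightarrow> i < M \<Longrightarrow>
       L \<le> card {p\<in>X. i \<in> files p \<and> srv p \<inter> (C \<union> C') = {}}"
    and corr_unwanted: "\<And>C C' \<Gamma>. C \<subseteq> {..<N} \<Longrightarrow> C' \<subseteq> {..<N} \<Longrightarrow> card C = B \<Longrightarrow> card C' = B \<Longrightarrow>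
       \<Gamma> \<noteq> {} \<Longrightarrow> \<Gamma> \<subseteq> {..<M} \<Longrightarrow> d \<Gamma> \<le> card {p\<in>X. files p = \<Gamma> \<and> srv p \<inter> (C \<union> C') = {}}"
begin

section \<open>Coefficient vectors and their independence on the view of \<open>T\<close>
  servers\<close>

text \<open>Weight of row \<open>l\<close> of the random matrix of file \<open>m\<close> in
  coordinate \<open>p\<close>. Removing \<open>i\<close> from \<open>files p\<close> assigns the
  blocks of \<Gamma> and of \<open>insert i \<Gamma>\<close> to the same rows, which makes their
  interference one codeword.\<close>

definition bv :: "nat \<Rightarrow> nat \<Rightarrow> 'x \<Rightarrow> nat \<Rightarrow> 'a" where
  "bv i m p l = (if m = i then pt p [^] l
     else if fst (\<gamma> i m l) = files p - {i} then pt p [^] snd (\<gamma> i m l) else \<zero>)"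

definition seen :: "nat set \<Rightarrow> nat \<Rightarrow> 'x set" where
  "seen C m = {p\<in>X. m \<in> files p \<and> srv p \<inter> C \<noteq> {}}"

lemma bv_closed: "p \<in> X \<Longrightarrow> bv i m p l \<in> carrier F"
  using pt by (auto simp: bv_def)

lemma finite_seen: "finite (seen C m)"
  using finX by (simp add: seen_def)

lemma vandermonde_indep_pt:
  assumes "J \<subseteq> X" "card J \<le> n"
  shows "indep {..<n} J (\<lambda>p j. pt p [^] j)"
  using assms pt finX
  by (intro vandermonde_indep) (auto intro: finite_subset inj_on_subset)

text \<open>For the wanted file, at most \<open>L\<close> Vandermonde vectors of length
  \<open>L\<close> are seen. For another file the rows of the matrix are split among the groups
  \<Gamma>, so a relation splits into one relation per group, and there \<open>priv_unwanted\<close>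
  bounds the number of vectors by the dimension.\<close>

lemma bv_indep:
  assumes C: "C \<subseteq> {..<N}" "card C = T" and i: "i < M" "m < M"
  shows "indep {..<L} (seen C m) (bv i m)"
proof (cases "m = i")
  case True
  then have "bv i m = (\<lambda>p j. pt p [^] j)" by (simp add: bv_def fun_eq_iff)
  then show ?thesis
    using vandermonde_indep_pt[of "seen C i" L] priv_wanted[OF C i(1)] True by (auto simp: seen_def)
next
  case False
  show ?thesis
    unfolding indep_def
  proof (intro ballI impI)
    fix c p0 assume c: "c \<in> seen C m \<rightarrow> carrier F" "\<forall>l\<in>{..<L}. dot (seen C m) c (\<lambda>p. bv i m p l) = \<zero>"
      and p0: "p0 \<in> seen C m"
    let ?\<Gamma> = "files p0 - {i}"
    let ?J = "{p \<in> seen C m. files p - {i} = ?\<Gamma>}"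
    have p0X: "p0 \<in> X" "m \<in> files p0" using p0 by (auto simp: seen_def)
    then have \<Gamma>: "m \<in> ?\<Gamma>" "?\<Gamma> \<subseteq> {..<M} - {i}" "?\<Gamma> \<noteq> {}" using files[of p0] False by auto
    have "?J \<subseteq> {p\<in>X. files p - {i} = ?\<Gamma> \<and> srv p \<inter> C \<noteq> {}}" by (auto simp: seen_def)
    then have "card ?J \<le> card {p\<in>X. files p - {i} = ?\<Gamma> \<and> srv p \<inter> C \<noteq> {}}"
      using finX by (intro card_mono) auto
    then have J: "?J \<subseteq> X" "card ?J \<le> d ?\<Gamma>"
      using priv_unwanted[OF C i(1) \<Gamma>(3,2)] by (auto simp: seen_def)
    \<comment> \<open>In the row labelled \<open>(?\<Gamma>, j)\<close> every coordinate outside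
      \<open>?J\<close> has weight zero, so this row alone gives the relation for the exponent
      \<open>j\<close>.\<close>
    have z: "dot ?J c (\<lambda>p. pt p [^] j) = \<zero>" if j: "j \<in> {..<d ?\<Gamma>}" for j
    proof -
      have "j \<in> (\<lambda>l. snd (\<gamma> i m l)) ` {l. l < L \<and> fst (\<gamma> i m l) = ?\<Gamma>}"
        using bij_betw_imp_surj_on[OF \<gamma>[OF i(1) False \<Gamma>(1,2)]] j by (rule ssubst)
      then obtain l where l: "l < L" "fst (\<gamma> i m l) = ?\<Gamma>" "snd (\<gamma> i m l) = j" by blast
      have "dot (seen C m) c (\<lambda>p. bv i m p l) = dot ?J c (\<lambda>p. pt p [^] j)"
        unfolding dot_def using c(1) finite_seen pt(1) False l J(1)
        by (intro add.finprod_mono_neutral_cong_right)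
          (auto simp: bv_def Pi_iff seen_def)
      then show ?thesis using c(2) l by auto
    qed
    have "c \<in> ?J \<rightarrow> carrier F" using c by auto
    from indepD[OF vandermonde_indep_pt[OF J] this z] p0 show "c p0 = \<zero>" by auto
  qed
qed

lemma card_seen:
  assumes "C \<subseteq> {..<N}" "card C = T" "m < M"
  shows "card (seen C m) \<le> L"
  using priv_wanted[OF assms] by (simp add: seen_def)

lemma bv_Pi: "J \<subseteq> X \<Longrightarrow> bv i m \<in> J \<rightarrow> I \<rightarrow> carrier F"
  using bv_closed by auto

section \<open>Query vectors and responses\<close>

definition qvec :: "nat \<Rightarrow> (nat \<Rightarrow> nat \<Rightarrow> nat \<Rightarrow> 'a) \<Rightarrow> nat \<Rightarrow> 'x \<Rightarrow> nat \<Rightarrow> 'a" where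
  "qvec i U m p = act L (bv i m p) (U m)"

text \<open>\<open>y\<close> is the content of a single server: one vector of length
  \<open>L\<close> for each file.\<close>

definition resp :: "nat \<Rightarrow> (nat \<Rightarrow> nat \<Rightarrow> nat \<Rightarrow> 'a) \<Rightarrow> (nat \<Rightarrow> nat \<Rightarrow> 'a) \<Rightarrow> 'x \<Rightarrow> 'a" where
  "resp i U y p = (\<Oplus>m\<in>files p. dot {..<L} (qvec i U m p) (y m))"

lemma qvec_closed:
  assumes "U \<in> {..<M} \<rightarrow>\<^sub>E gl L" "m < M" "p \<in> X"
  shows "qvec i U m p \<in> {..<L} \<rightarrow>\<^sub>E carrier F"
  unfolding qvec_def using assms bv_closed by (intro act_closed) (auto simp: PiE_iff)

lemma resp_add:
  assumes "U \<in> {..<M} \<rightarrow>\<^sub>E gl L" "p \<in> X" "\<And>m. m < M \<Longrightarrow> y m \<in> {..<L} \<rightarrow> carrier F"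
    "\<And>m. m < M \<Longrightarrow> z m \<in> {..<L} \<rightarrow> carrier F"
    and "\<And>m l. m < M \<Longrightarrow> l < L \<Longrightarrow> x m l = y m l \<oplus> z m l"
  shows "resp i U x p = resp i U y p \<oplus> resp i U z p"
proof -
  have m: "m < M" if "m \<in> files p" for m using files assms(2) that by auto
  have q: "qvec i U m p \<in> {..<L} \<rightarrow> carrier F" if "m \<in> files p" for m
    using qvec_closed[OF assms(1) m[OF that] assms(2)] by auto
  have "resp i U x p = (\<Oplus>m\<in>files p. dot {..<L} (qvec i U m p) (y m) \<oplus> dot {..<L} (qvec i U m p) (z m))"
    unfolding resp_def
  proof (intro finsum_cong' refl)
    fix k assume k: "k \<in> files p"
    have "dot {..<L} (qvec i U k p) (x k) = dot {..<L} (qvec i U k p) (\<lambda>l. y k l \<oplus> z k l)"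
      using q[OF k] assms(3,4,5)[OF m[OF k]] by (intro dot_cong) (auto simp: Pi_iff)
    also have "\<dots> = dot {..<L} (qvec i U k p) (y k) \<oplus> dot {..<L} (qvec i U k p) (z k)"
      using q[OF k] assms(3,4)[OF m[OF k]] by (intro dot_add_right)
    finally show "dot {..<L} (qvec i U k p) (x k)
      = dot {..<L} (qvec i U k p) (y k) \<oplus> dot {..<L} (qvec i U k p) (z k)" .
  qed (use q assms(3,4) m in auto)
  also have "\<dots> = resp i U y p \<oplus> resp i U z p"
    unfolding resp_def using q assms(3,4) m by (intro finsum_addf) auto
  finally show ?thesis .
qed

lemma resp_closed:
  assumes "U \<in> {..<M} \<rightarrow>\<^sub>E gl L" "p \<in> X" "\<And>m. m < M \<Longrightarrow> y m \<in> {..<L} \<rightarrow> carrier F"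
  shows "resp i U y p \<in> carrier F"
proof -
  have "m < M" if "m \<in> files p" for m using files assms(2) that by auto
  then show ?thesis
    using qvec_closed[OF assms(1) _ assms(2)] assms(3)
    unfolding resp_def by (intro finsum_closed Pi_I dot_closed) (auto simp: Pi_iff)
qed

section \<open>Unique decoding despite Byzantine servers\<close>

lemma G_closed: "k < K \<Longrightarrow> n < N \<Longrightarrow> G k n \<in> carrier F"
  using mds unfolding mds_matrix_def matrices_def by (auto simp: PiE_iff)

lemma G_indep: "S \<subseteq> {..<N} \<Longrightarrow> card S = K \<Longrightarrow> indep {..<K} S (\<lambda>n k. G k n)"
  using mds unfolding mds_matrix_def indep_def dot_def by auto

text \<open>Here \<open>C\<close> and \<open>C'\<close> are two candidate Byzantine sets, and \<open>\<Delta>\<close> is the difference of two file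
  tuples that explain the same answers.\<close>

lemma wanted_file_zero:
  assumes U: "U \<in> {..<M} \<rightarrow>\<^sub>E gl L" and i: "i < M"
    and \<Delta>: "\<And>m l k. m < M \<Longrightarrow> l < L \<Longrightarrow> k < K \<Longrightarrow> \<Delta> m l k \<in> carrier F"
    and C: "C \<subseteq> {..<N}" "C' \<subseteq> {..<N}" "card C = B" "card C' = B"
    and z: "\<And>p n. p \<in> X \<Longrightarrow> srv p \<inter> (C \<union> C') = {} \<Longrightarrow> n \<in> srv p \<Longrightarrow>
       resp i U (\<lambda>m l. \<Oplus>k\<in>{..<K}. \<Delta> m l k \<otimes> G k n) p = \<zero>"
    and l: "l < L" and k: "k < K"
  shows "\<Delta> i l k = \<zero>"
proof -
  let ?E = "{p\<in>X. srv p \<inter> (C \<union> C') = {}}"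
  have U': "U m \<in> gl L" if "m < M" for m using U that by auto
  have Uc: "U m j l \<in> carrier F" if "m < M" "j < L" "l < L" for m j l
    using gl_carrier(1)[OF U'[OF that(1)]] that by (auto simp: Pi_iff)
  have tM: "m < M" if "m \<in> files p" "p \<in> X" for m p using files(1) that by auto
  have qc: "qvec i U m p l \<in> carrier F" if "m < M" "p \<in> X" "l < L" for m p l
    using qvec_closed[OF U that(1,2)] that(3) by auto
  \<comment> \<open>\<open>?s k\<close> is the response that column \<open>k\<close> of \<Delta>
    would give. Each server of \<open>srv p\<close> only yields its inner product with one column of
    \<open>G\<close>, but these \<open>K\<close> columns are independent, so all \<open>K\<close>
    responses vanish.\<close>
  have rows: "resp i U (\<lambda>m l. \<Delta> m l k) p = \<zero>" if p: "p \<in> ?E" for p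
  proof -
    let ?s = "\<lambda>k. resp i U (\<lambda>m l. \<Delta> m l k) p"
    have pX: "p \<in> X" using p by auto
    have sc: "?s \<in> {..<K} \<rightarrow> carrier F"
      using pX \<Delta> by (intro Pi_I resp_closed[OF U pX]) auto
    have "dot {..<K} (\<lambda>k. G k n) ?s = \<zero>" if n: "n \<in> srv p" for n
    proof -
      have nN: "n < N" using srv(1)[OF pX] n by auto
      have "dot {..<L} (qvec i U m p) (\<lambda>l. \<Oplus>k\<in>{..<K}. \<Delta> m l k \<otimes> G k n)
          = (\<Oplus>k\<in>{..<K}. G k n \<otimes> dot {..<L} (qvec i U m p) (\<lambda>l. \<Delta> m l k))" if m: "m < M" for m
      proof -
        have D: "(\<lambda>l. \<Delta> m l k) \<in> {..<L} \<rightarrow> carrier F" if "k \<in> {..<K}" for k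
          using \<Delta>[OF m] that by auto
        have g: "(\<lambda>k. G k n) \<in> {..<K} \<rightarrow> carrier F" using G_closed nN by auto
        have "dot {..<L} (qvec i U m p) (\<lambda>l. \<Oplus>k\<in>{..<K}. \<Delta> m l k \<otimes> G k n)
           = dot {..<L} (\<lambda>l. dot {..<K} (\<lambda>k. G k n) (\<lambda>k. \<Delta> m l k)) (qvec i U m p)"
        proof (subst dot_commute)
          show "dot {..<L} (\<lambda>l. \<Oplus>k\<in>{..<K}. \<Delta> m l k \<otimes> G k n) (qvec i U m p)
            = dot {..<L} (\<lambda>l. dot {..<K} (\<lambda>k. G k n) (\<lambda>k. \<Delta> m l k)) (qvec i U m p)"
            using \<Delta>[OF m] qc[OF m pX] G_closed nN
            by (intro dot_cong) (auto simp: dot_def m_comm intro!: finsum_cong' finsum_closed)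
        qed (use \<Delta>[OF m] qc[OF m pX] G_closed nN in \<open>auto intro!: finsum_closed\<close>)
        also have "\<dots> = dot {..<K} (\<lambda>k. G k n) (\<lambda>k. dot {..<L} (\<lambda>l. \<Delta> m l k) (qvec i U m p))"
          using D g qc[OF m pX] by (intro dot_dot) auto
        also have "\<dots> = dot {..<K} (\<lambda>k. G k n) (\<lambda>k. dot {..<L} (qvec i U m p) (\<lambda>l. \<Delta> m l k))"
          using D g qc[OF m pX] by (intro dot_cong dot_commute refl) auto
        finally show ?thesis by (simp add: dot_def)
      qed
      note row = this
      have dc: "dot {..<L} (qvec i U m p) (\<lambda>l. \<Delta> m l k) \<in> carrier F" if "m < M" "k < K" for m k
        using qc[OF that(1) pX] \<Delta>[OF that(1) _ that(2)] by (intro dot_closed) auto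
      have "\<zero> = resp i U (\<lambda>m l. \<Oplus>k\<in>{..<K}. \<Delta> m l k \<otimes> G k n) p"
        using z p n by auto
      also have "\<dots> = (\<Oplus>m\<in>files p. \<Oplus>k\<in>{..<K}. G k n \<otimes> dot {..<L} (qvec i U m p) (\<lambda>l. \<Delta> m l k))"
        unfolding resp_def using row tM[OF _ pX] dc G_closed nN
        by (intro finsum_cong') (auto intro!: finsum_closed)
      also have "\<dots> = (\<Oplus>k\<in>{..<K}. \<Oplus>m\<in>files p. G k n \<otimes> dot {..<L} (qvec i U m p) (\<lambda>l. \<Delta> m l k))"
        using tM[OF _ pX] dc G_closed nN files(1)[OF pX]
        by (intro finsum_swap) (auto intro: finite_subset)
      also have "\<dots> = dot {..<K} (\<lambda>k. G k n) ?s"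
        unfolding dot_def[of "{..<K}"] resp_def using tM[OF _ pX] dc G_closed nN files(1)[OF pX]
        by (intro finsum_cong' refl)
          (auto intro!: finsum_rdistr[symmetric] finsum_closed intro: finite_subset)
      finally show ?thesis by simp
    qed
    then show ?thesis
      using srv[OF pX] k G_closed sc G_indep[OF srv[OF pX]]
      by (intro dot_eq_zero_imp_zero[OF finF, of "{..<K}" "srv p" "\<lambda>n k. G k n" ?s k])
        (auto intro: finite_subset simp: Pi_iff)
  qed
  \<comment> \<open>Products of the rows of \<open>U m\<close> with column \<open>k\<close>: the
    message symbols that are encoded with the weights \<open>bv\<close>.\<close>
  define y where "y m j = dot {..<L} (U m j) (\<lambda>l. \<Delta> m l k)" for m j
  have yc: "y m j \<in> carrier F" if "m < M" "j < L" for m j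
    unfolding y_def using Uc[OF that] \<Delta>[OF that(1) _ k] by (intro dot_closed) auto
  have qy: "dot {..<L} (qvec i U m p) (\<lambda>l. \<Delta> m l k) = dot {..<L} (bv i m p) (y m)"
    if "m < M" "p \<in> X" for m p
  proof -
    have "dot {..<L} (qvec i U m p) (\<lambda>l. \<Delta> m l k)
       = dot {..<L} (\<lambda>l. dot {..<L} (bv i m p) (\<lambda>j. U m j l)) (\<lambda>l. \<Delta> m l k)"
      using bv_closed[OF that(2)] Uc[OF that(1)] \<Delta>[OF that(1) _ k]
      by (intro dot_cong) (auto simp: qvec_def act_def intro!: dot_closed)
    also have "\<dots> = dot {..<L} (bv i m p) (\<lambda>j. dot {..<L} (U m j) (\<lambda>l. \<Delta> m l k))"
      using bv_closed[OF that(2)] Uc[OF that(1)] \<Delta>[OF that(1) _ k]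
      by (intro dot_dot) auto
    finally show ?thesis by (simp add: y_def[abs_def])
  qed
  have interference: "(\<Oplus>m\<in>\<Gamma>. dot {..<L} (bv i m p) (y m)) = \<zero>"
    if \<Gamma>: "\<Gamma> \<subseteq> {..<M} - {i}" and p: "p \<in> X" "files p - {i} = \<Gamma>" for \<Gamma> p
  proof (cases "\<Gamma> = {}")
    case False
    have fin\<Gamma>: "finite \<Gamma>" using \<Gamma> by (rule finite_subset) simp
    have \<Gamma>M: "m < M" "m \<noteq> i" if "m \<in> \<Gamma>" for m using \<Gamma> that by auto
    let ?A = "\<lambda>m. {l. l < L \<and> fst (\<gamma> i m l) = \<Gamma>}"
    \<comment> \<open>\<open>h m j\<close> is the row of file \<open>m\<close> that carries the
      \<open>j\<close>-th message symbol of the code of \<Gamma>.\<close>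
    define h where "h m = inv_into (?A m) (\<lambda>l. snd (\<gamma> i m l))" for m
    have hb: "bij_betw (h m) {..<d \<Gamma>} (?A m)" if "m \<in> \<Gamma>" for m
      unfolding h_def by (rule bij_betw_inv_into[OF \<gamma>[OF i \<Gamma>M(2)[OF that] that \<Gamma>]])
    have hL: "h m j < L" "fst (\<gamma> i m (h m j)) = \<Gamma>" "snd (\<gamma> i m (h m j)) = j"
      if "m \<in> \<Gamma>" "j < d \<Gamma>" for m j
      using bij_betwE[OF hb[OF that(1)]] that(2)
        bij_betw_inv_into_right[OF \<gamma>[OF i \<Gamma>M(2)[OF that(1)] that(1) \<Gamma>], of j]
      by (auto simp: h_def)
    \<comment> \<open>All files of \<Gamma> use the same code, so the sum of their codewords is the
      codeword of the summed messages \<open>w\<close>.\<close>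
    define w where "w j = (\<Oplus>m\<in>\<Gamma>. y m (h m j))" for j
    have wc: "w j \<in> carrier F" if "j < d \<Gamma>" for j
      unfolding w_def using yc \<Gamma>M hL that by (intro finsum_closed) auto
    have code: "(\<Oplus>m\<in>\<Gamma>. dot {..<L} (bv i m p') (y m)) = dot {..<d \<Gamma>} (\<lambda>j. pt p' [^] j) w"
      if p': "p' \<in> X" "files p' - {i} = \<Gamma>" for p'
    proof -
      have ptc: "pt p' \<in> carrier F" using pt p' by auto
      have "dot {..<L} (bv i m p') (y m) = (\<Oplus>j\<in>{..<d \<Gamma>}. pt p' [^] j \<otimes> y m (h m j))"
        if m: "m \<in> \<Gamma>" for m
      proof -
        have "dot {..<L} (bv i m p') (y m) = (\<Oplus>l\<in>?A m. pt p' [^] snd (\<gamma> i m l) \<otimes> y m l)"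
          unfolding dot_def using yc \<Gamma>M[OF m] p' ptc
          by (intro add.finprod_mono_neutral_cong_right) (auto simp: bv_def)
        also have "\<dots> = (\<Oplus>l\<in>h m ` {..<d \<Gamma>}. pt p' [^] snd (\<gamma> i m l) \<otimes> y m l)"
          using bij_betw_imp_surj_on[OF hb[OF m]] by simp
        also have "\<dots> = (\<Oplus>j\<in>{..<d \<Gamma>}. pt p' [^] snd (\<gamma> i m (h m j)) \<otimes> y m (h m j))"
          using yc \<Gamma>M[OF m] hL[OF m] ptc bij_betw_imp_inj_on[OF hb[OF m]]
          by (intro finsum_reindex) auto
        also have "\<dots> = (\<Oplus>j\<in>{..<d \<Gamma>}. pt p' [^] j \<otimes> y m (h m j))"
          using yc \<Gamma>M[OF m] hL[OF m] ptc by (intro finsum_cong') auto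
        finally show ?thesis .
      qed
      then have "(\<Oplus>m\<in>\<Gamma>. dot {..<L} (bv i m p') (y m))
          = (\<Oplus>m\<in>\<Gamma>. \<Oplus>j\<in>{..<d \<Gamma>}. pt p' [^] j \<otimes> y m (h m j))"
        using yc \<Gamma>M hL ptc by (intro finsum_cong') (auto intro!: finsum_closed)
      also have "\<dots> = (\<Oplus>j\<in>{..<d \<Gamma>}. \<Oplus>m\<in>\<Gamma>. pt p' [^] j \<otimes> y m (h m j))"
        using yc \<Gamma>M hL ptc fin\<Gamma> by (intro finsum_swap) auto
      also have "\<dots> = dot {..<d \<Gamma>} (\<lambda>j. pt p' [^] j) w"
        unfolding dot_def w_def using yc \<Gamma>M hL ptc fin\<Gamma>
        by (intro finsum_cong' refl) (auto intro!: finsum_closed finsum_rdistr[symmetric])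
      finally show ?thesis .
    qed
    have "d \<Gamma> \<le> card {p\<in>X. files p = \<Gamma> \<and> srv p \<inter> (C \<union> C') = {}}"
      using corr_unwanted[OF C False] \<Gamma> by auto
    then obtain J where J: "J \<subseteq> {p\<in>X. files p = \<Gamma> \<and> srv p \<inter> (C \<union> C') = {}}" "card J = d \<Gamma>"
      by (rule obtain_subset_with_card_n)
    have JX: "J \<subseteq> X" and finJ: "finite J" using J(1) finX by (auto intro: finite_subset)
    \<comment> \<open>In the blocks of \<Gamma> itself the interference is the entire response, and
      \<open>corr_unwanted\<close> supplies enough clean coordinates there to determine the
      codeword.\<close>
    have w0: "w j = \<zero>" if j: "j < d \<Gamma>" for j
    proof (rule dot_eq_zero_imp_zero[OF finF finite_lessThan finJ _ vandermonde_indep_pt[OF JX], where y = w and n1 = "d \<Gamma>"])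
      fix p' assume p': "p' \<in> J"
      have "files p' - {i} = \<Gamma>" "files p' = \<Gamma>" "p' \<in> ?E" "p' \<in> X" using J(1) p' \<Gamma> by auto
      have "dot {..<d \<Gamma>} (\<lambda>j. pt p' [^] j) w = (\<Oplus>m\<in>\<Gamma>. dot {..<L} (bv i m p') (y m))"
        using code[OF \<open>p' \<in> X\<close> \<open>files p' - {i} = \<Gamma>\<close>] by simp
      also have "\<dots> = resp i U (\<lambda>m l. \<Delta> m l k) p'"
        unfolding resp_def \<open>files p' = \<Gamma>\<close> using qy \<Gamma>M \<open>p' \<in> X\<close> bv_closed yc
        by (intro finsum_cong') (auto intro!: dot_closed)
      also have "\<dots> = \<zero>" by (rule rows[OF \<open>p' \<in> ?E\<close>])
      finally show "dot {..<d \<Gamma>} (\<lambda>j. pt p' [^] j) w = \<zero>" .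
    qed (use J j wc pt JX in \<open>auto simp: Pi_iff\<close>)
    have "(\<Oplus>m\<in>\<Gamma>. dot {..<L} (bv i m p) (y m)) = dot {..<d \<Gamma>} (\<lambda>j. pt p [^] j) w"
      by (rule code[OF p])
    also have "\<dots> = \<zero>" using w0 pt p by (intro dot_zero_right) auto
    finally show ?thesis .
  qed (simp add: finsum_empty)
  have wanted: "dot {..<L} (\<lambda>j. pt p [^] j) (y i) = \<zero>" if p: "p \<in> ?E" "i \<in> files p" for p
  proof -
    have pX: "p \<in> X" using p by auto
    have fint: "finite (files p)" using files(1)[OF pX] by (rule finite_subset) simp
    have dc: "dot {..<L} (bv i m p) (y m) \<in> carrier F" if "m < M" for m
      using bv_closed[OF pX] yc[OF that] by (intro dot_closed) auto
    have "\<zero> = resp i U (\<lambda>m l. \<Delta> m l k) p" using rows[OF p(1)] by simp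
    also have "\<dots> = (\<Oplus>m\<in>insert i (files p - {i}). dot {..<L} (bv i m p) (y m))"
      unfolding resp_def insert_Diff[OF p(2)] using qy[OF _ pX] tM[OF _ pX] dc
      by (intro finsum_cong') auto
    also have "\<dots> = dot {..<L} (bv i i p) (y i) \<oplus> (\<Oplus>m\<in>files p - {i}. dot {..<L} (bv i m p) (y m))"
      using fint dc tM[OF _ pX] i by (intro finsum_insert) auto
    also have "(\<Oplus>m\<in>files p - {i}. dot {..<L} (bv i m p) (y m)) = \<zero>"
      using files(1)[OF pX] pX by (intro interference) auto
    also have "dot {..<L} (bv i i p) (y i) \<oplus> \<zero> = dot {..<L} (bv i i p) (y i)"
      using dc[OF i] by simp
    also have "bv i i p = (\<lambda>j. pt p [^] j)" by (simp add: bv_def fun_eq_iff)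
    finally show ?thesis by simp
  qed
  \<comment> \<open>Without interference the wanted file has a single code across all its blocks, so
    any \<open>L\<close> clean coordinates give its \<open>L\<close> message symbols. Finally
    \<open>U i\<close> is inverted.\<close>
  obtain J where J: "J \<subseteq> {p\<in>X. i \<in> files p \<and> srv p \<inter> (C \<union> C') = {}}" "card J = L"
    using corr_wanted[OF C i] by (rule obtain_subset_with_card_n)
  have JX: "J \<subseteq> X" and finJ: "finite J" using J(1) finX by (auto intro: finite_subset)
  have y0: "y i j = \<zero>" if j: "j < L" for j
    by (rule dot_eq_zero_imp_zero[OF finF finite_lessThan finJ _ vandermonde_indep_pt[OF JX], where y = "y i" and n1 = L])
      (use J j yc[OF i] pt JX wanted in \<open>auto simp: Pi_iff\<close>)
  show ?thesis
    by (rule dot_eq_zero_imp_zero[OF finF finite_lessThan finite_lessThan refl gl_carrier(3,1)[OF U'[OF i]],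
          where y = "\<lambda>l. \<Delta> i l k"])
      (use y0 l \<Delta>[OF i _ k] in \<open>auto simp: y_def\<close>)
qed

section \<open>File tuples, and uniqueness of the wanted file\<close>

abbreviation "\<Omega> \<equiv> file_tuples F K M L"
abbreviation "Us \<equiv> {..<M} \<rightarrow>\<^sub>E gl L"

definition coords :: "nat \<Rightarrow> 'x set" where
  "coords n = {p\<in>X. n \<in> srv p}"

lemma finite_coords: "finite (coords n)"
  using finX by (simp add: coords_def)

lemma \<Omega>_iff: "W \<in> \<Omega> \<longleftrightarrow> W \<in> {..<M} \<rightarrow>\<^sub>E {..<L} \<rightarrow>\<^sub>E {..<K} \<rightarrow>\<^sub>E carrier F"
  by (simp add: file_tuples_def matrices_def)

lemma \<Omega>_closed: "W \<in> \<Omega> \<Longrightarrow> m < M \<Longrightarrow> l < L \<Longrightarrow> k < K \<Longrightarrow> W m l k \<in> carrier F"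
  unfolding \<Omega>_iff by (auto simp: PiE_iff)

lemma \<Omega>_restrict:
  assumes "\<And>m l k. m < M \<Longrightarrow> l < L \<Longrightarrow> k < K \<Longrightarrow> w m l k \<in> carrier F"
  shows "(\<lambda>m\<in>{..<M}. \<lambda>l\<in>{..<L}. \<lambda>k\<in>{..<K}. w m l k) \<in> \<Omega>"
  unfolding \<Omega>_iff using assms by (auto intro!: restrict_PiE_iff[THEN iffD2])

lemma finite_\<Omega>: "finite \<Omega>"
  unfolding file_tuples_def matrices_def using finF by (intro finite_PiE) auto

lemma \<Omega>_nonempty: "\<Omega> \<noteq> {}"
  using \<Omega>_restrict[of "\<lambda>_ _ _. \<zero>"] by auto

lemma matrices_ext:
  assumes "A \<in> matrices F r c" "A' \<in> matrices F r c" "\<And>l k. l < r \<Longrightarrow> k < c \<Longrightarrow> A l k = A' l k"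
  shows "A = A'"
proof (rule PiE_ext[OF assms(1,2)[unfolded matrices_def]])
  fix l assume l: "l \<in> {..<r}"
  then have "A l \<in> {..<c} \<rightarrow>\<^sub>E carrier F" "A' l \<in> {..<c} \<rightarrow>\<^sub>E carrier F"
    using assms(1,2) unfolding matrices_def by blast+
  then show "A l = A' l" by (rule PiE_ext) (use assms(3) l in auto)
qed

lemma stored_apply:
  "m < M \<Longrightarrow> l < L \<Longrightarrow> stored F K M L G W n m l = (\<Oplus>k\<in>{..<K}. W m l k \<otimes> G k n)"
  by (simp add: stored_def)

lemma stored_closed:
  "W \<in> \<Omega> \<Longrightarrow> n < N \<Longrightarrow> m < M \<Longrightarrow> stored F K M L G W n m \<in> {..<L} \<rightarrow> carrier F"
  using \<Omega>_closed G_closed by (auto simp: stored_apply intro!: finsum_closed)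

definition madd :: "(nat \<Rightarrow> nat \<Rightarrow> nat \<Rightarrow> 'a) \<Rightarrow> (nat \<Rightarrow> nat \<Rightarrow> nat \<Rightarrow> 'a) \<Rightarrow> nat \<Rightarrow> nat \<Rightarrow> nat \<Rightarrow> 'a" where
  "madd W V = (\<lambda>m\<in>{..<M}. \<lambda>l\<in>{..<L}. \<lambda>k\<in>{..<K}. W m l k \<oplus> V m l k)"

lemma madd_closed: "W \<in> \<Omega> \<Longrightarrow> V \<in> \<Omega> \<Longrightarrow> madd W V \<in> \<Omega>"
  unfolding madd_def using \<Omega>_closed by (intro \<Omega>_restrict) auto

lemma resp_stored_add:
  assumes "U \<in> Us" "p \<in> X" "n < N" "W \<in> \<Omega>" "V \<in> \<Omega>"
    and Z: "\<And>m l k. m < M \<Longrightarrow> l < L \<Longrightarrow> k < K \<Longrightarrow> Z m l k = W m l k \<oplus> V m l k"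
  shows "resp i U (\<lambda>m l. \<Oplus>k\<in>{..<K}. Z m l k \<otimes> G k n) p
    = resp i U (stored F K M L G W n) p \<oplus> resp i U (stored F K M L G V n) p"
proof (rule resp_add[OF assms(1,2) stored_closed[OF assms(4,3)] stored_closed[OF assms(5,3)]])
  fix m l assume ml: "m < M" "l < L"
  have "(\<Oplus>k\<in>{..<K}. Z m l k \<otimes> G k n) = (\<Oplus>k\<in>{..<K}. W m l k \<otimes> G k n \<oplus> V m l k \<otimes> G k n)"
    using ml assms \<Omega>_closed G_closed by (intro finsum_cong') (auto simp: l_distr)
  also have "\<dots> = stored F K M L G W n m l \<oplus> stored F K M L G V n m l"
    unfolding stored_apply[OF ml] using ml assms \<Omega>_closed G_closed by (intro finsum_addf) auto
  finally show "(\<Oplus>k\<in>{..<K}. Z m l k \<otimes> G k n)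
    = stored F K M L G W n m l \<oplus> stored F K M L G V n m l" .
qed

lemma resp_cong:
  assumes "U \<in> Us" "p \<in> X" "\<And>m. m < M \<Longrightarrow> y m \<in> {..<L} \<rightarrow> carrier F"
    and "\<And>m l. m < M \<Longrightarrow> l < L \<Longrightarrow> x m l = y m l"
  shows "resp i U x p = resp i U y p"
proof -
  have m: "m < M" if "m \<in> files p" for m using files assms(2) that by auto
  have q: "qvec i U m p \<in> {..<L} \<rightarrow> carrier F" if "m \<in> files p" for m
    using qvec_closed[OF assms(1) m[OF that] assms(2)] by auto
  show ?thesis
    unfolding resp_def using q assms(3,4) m
    by (intro finsum_cong' refl dot_cong) (auto intro!: dot_closed simp: Pi_iff)
qed

text \<open>Responses are additive in the files, so the difference of two tuples that agree outside
  both candidate sets satisfies the hypotheses of \<open>wanted_file_zero\<close>.\<close>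

lemma wanted_file_unique:
  assumes U: "U \<in> Us" and i: "i < M" and W: "W \<in> \<Omega>" "W' \<in> \<Omega>"
    and C: "C \<subseteq> {..<N}" "C' \<subseteq> {..<N}" "card C = B" "card C' = B"
    and eq: "\<And>n p. n \<in> {..<N} - (C \<union> C') \<Longrightarrow> p \<in> coords n \<Longrightarrow>
       resp i U (stored F K M L G W n) p = resp i U (stored F K M L G W' n) p"
  shows "W i = W' i"
proof -
  let ?D = "\<lambda>m l k. W m l k \<ominus> W' m l k"
  define D where "D = (\<lambda>m\<in>{..<M}. \<lambda>l\<in>{..<L}. \<lambda>k\<in>{..<K}. ?D m l k)"
  have D: "D \<in> \<Omega>" unfolding D_def using \<Omega>_closed W by (intro \<Omega>_restrict) auto
  have Dap: "D m l k = ?D m l k" if "m < M" "l < L" "k < K" for m l k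
    using that by (simp add: D_def)
  have "D i l k = \<zero>" if lk: "l < L" "k < K" for l k
  proof (rule wanted_file_zero[OF U i _ C _ lk])
    fix p n assume p: "p \<in> X" "srv p \<inter> (C \<union> C') = {}" and n: "n \<in> srv p"
    have n': "n \<in> {..<N} - (C \<union> C')" "p \<in> coords n" using p n srv(1)[OF p(1)] by (auto simp: coords_def)
    then have nN: "n < N" by simp
    let ?r = "\<lambda>W. resp i U (stored F K M L G W n) p"
    have rc: "?r V \<in> carrier F" if "V \<in> \<Omega>" for V
      using resp_closed[OF U p(1) stored_closed[OF that nN]] .
    have "?r W = resp i U (\<lambda>m l. \<Oplus>k\<in>{..<K}. W m l k \<otimes> G k n) p"
      using stored_closed[OF W(1) nN]
      by (intro resp_cong[OF U p(1)]) (auto simp: stored_apply Pi_iff)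
    also have "\<dots> = ?r D \<oplus> ?r W'"
      using \<Omega>_closed[OF W(1)] \<Omega>_closed[OF W(2)]
      by (intro resp_stored_add[OF U p(1) nN D W(2)]) (simp add: Dap minus_eq a_assoc l_neg)
    also have "?r W' = ?r W" using eq[OF n'] by simp
    finally have "?r D = \<zero>" using rc[OF W(1)] rc[OF D] by (metis add.r_cancel_one')
    moreover have "resp i U (\<lambda>m l. \<Oplus>k\<in>{..<K}. D m l k \<otimes> G k n) p = ?r D"
      using stored_closed[OF D nN]
      by (intro resp_cong[OF U p(1)]) (auto simp: stored_apply Pi_iff)
    ultimately show "resp i U (\<lambda>m l. \<Oplus>k\<in>{..<K}. D m l k \<otimes> G k n) p = \<zero>" by simp
  qed (use \<Omega>_closed[OF D] in auto)
  then have *: "W i l k = W' i l k" if "l < L" "k < K" for l k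
    using Dap[OF i that] \<open>\<And>l k. l < L \<Longrightarrow> k < K \<Longrightarrow> D i l k = \<zero>\<close>[OF that]
      \<Omega>_closed[OF W(1) i that] \<Omega>_closed[OF W(2) i that] by (metis r_right_minus_eq)
  have "W i \<in> matrices F L K" "W' i \<in> matrices F L K"
    using W i by (auto simp: file_tuples_def)
  then show ?thesis using * by (rule matrices_ext)
qed

section \<open>Distribution of the answers of one server and of one file\<close>

definition resps :: "nat \<Rightarrow> (nat \<Rightarrow> nat \<Rightarrow> nat \<Rightarrow> 'a) \<Rightarrow> nat \<Rightarrow> (nat \<Rightarrow> nat \<Rightarrow> nat \<Rightarrow> 'a) \<Rightarrow> 'x \<Rightarrow> 'a" where
  "resps i U n W = (\<lambda>p\<in>coords n. resp i U (stored F K M L G W n) p)"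

lemma resps_closed:
  assumes "U \<in> Us" "n < N" "W \<in> \<Omega>"
  shows "resps i U n W \<in> coords n \<rightarrow>\<^sub>E carrier F"
  using resp_closed[OF assms(1) _ stored_closed[OF assms(3,2)]] by (auto simp: resps_def coords_def)

text \<open>For each file the query vectors at server \<open>n\<close> are independent, so the
  contribution of every file to every coordinate can be prescribed separately; a suitable content of
  the server is then lifted to a file tuple.\<close>

lemma resps_surj:
  assumes U: "U \<in> Us" and i: "i < M" and n: "n < N" and z: "z \<in> coords n \<rightarrow>\<^sub>E carrier F"
  obtains W where "W \<in> \<Omega>" "resps i U n W = z"
proof -
  \<comment> \<open>Server \<open>n\<close> is put into a set of \<open>T\<close> servers, where
    \<open>bv_indep\<close> and \<open>card_seen\<close> apply.\<close>
  obtain C where C: "{n} \<subseteq> C" "C \<subseteq> {..<N}" "card C = T"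
    using exists_subset_between[of "{n}" T "{..<N}"] T n by auto
  define J where "J m = {p\<in>coords n. m \<in> files p}" for m
  have J: "J m \<subseteq> seen C m" "J m \<subseteq> X" for m using C(1) by (auto simp: J_def coords_def seen_def)
  \<comment> \<open>One file per coordinate, the least one, contributes the whole value
    \<open>z p\<close>; the other files contribute zero.\<close>
  have "\<forall>m\<in>{..<M}. \<exists>y. y \<in> {..<L} \<rightarrow> carrier F \<and>
      (\<forall>p\<in>J m. dot {..<L} (qvec i U m p) y = (if m = Min (files p) then z p else \<zero>))"
  proof
    fix m assume "m \<in> {..<M}"
    then have m: "m < M" by simp
    have Um: "U m \<in> gl L" using U m by auto
    have "indep {..<L} (J m) (bv i m)"
      by (rule indep_subset[OF bv_indep[OF C(2,3) i m] bv_Pi J(1) finite_seen]) (auto simp: seen_def)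
    then have ind: "indep {..<L} (J m) (qvec i U m)"
      unfolding qvec_def[abs_def] using J(2) finX
      by (intro indep_act[OF Um _ bv_Pi]) (auto intro: finite_subset)
    have Pi: "qvec i U m \<in> J m \<rightarrow> {..<L} \<rightarrow> carrier F"
      using qvec_closed[OF U m] J(2)[of m] by (auto simp: PiE_iff)
    have le: "card (J m) \<le> card {..<L}"
      using card_mono[OF finite_seen J(1)] card_seen[OF C(2,3) m] by (metis card_lessThan le_trans)
    have fin: "finite (J m)" using J(2) finX by (rule finite_subset)
    have zc: "(\<lambda>p. if m = Min (files p) then z p else \<zero>) \<in> J m \<rightarrow> carrier F"
      using z by (auto simp: J_def)
    obtain y where "y \<in> {..<L} \<rightarrow> carrier F"
      "\<And>p. p \<in> J m \<Longrightarrow> dot {..<L} (qvec i U m p) y = (if m = Min (files p) then z p else \<zero>)"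
      by (rule dot_prescribe[OF finF finite_lessThan fin le ind Pi zc]) blast
    then show "\<exists>y. y \<in> {..<L} \<rightarrow> carrier F \<and>
      (\<forall>p\<in>J m. dot {..<L} (qvec i U m p) y = (if m = Min (files p) then z p else \<zero>))" by blast
  qed
  from bchoice[OF this] obtain y where y: "\<And>m. m < M \<Longrightarrow> y m \<in> {..<L} \<rightarrow> carrier F"
    "\<And>m p. m < M \<Longrightarrow> p \<in> J m \<Longrightarrow> dot {..<L} (qvec i U m p) (y m) = (if m = Min (files p) then z p else \<zero>)"
    by blast
  \<comment> \<open>By the MDS property no column of \<open>G\<close> is zero. A nonzero entry
    allows the content of server \<open>n\<close> to be produced by column \<open>k0\<close> of the
    files alone.\<close>
  obtain k0 where k0: "k0 < K" "G k0 n \<noteq> \<zero>"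
  proof (rule ccontr)
    assume "\<not> thesis"
    then have G0: "\<And>k. k < K \<Longrightarrow> G k n = \<zero>" using that by blast
    obtain S where S: "{n} \<subseteq> S" "S \<subseteq> {..<N}" "card S = K"
      using exists_subset_between[of "{n}" K "{..<N}"] K n by auto
    have "indep {..<K} {n} (\<lambda>n k. G k n)"
      using S G_closed n by (intro indep_subset[OF G_indep[OF S(2,3)]]) (auto intro: finite_subset)
    moreover have "dot {n} (\<lambda>_. \<one>) (\<lambda>n. G k n) = \<zero>" if "k \<in> {..<K}" for k
      using G0 that by (intro dot_zero_right) auto
    ultimately have "\<one> = \<zero>"
      using indepD[of "{..<K}" "{n}" "\<lambda>n k. G k n" "\<lambda>_. \<one>" n] by simp
    then show False by simp
  qed
  define W where "W = (\<lambda>m\<in>{..<M}. \<lambda>l\<in>{..<L}. \<lambda>k\<in>{..<K}. if k0 = k then y m l \<otimes> inv (G k0 n) else \<zero>)"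
  have Gu: "G k0 n \<in> Units F" using k0 G_closed n field_Units by auto
  have W: "W \<in> \<Omega>" unfolding W_def using y(1) Gu by (intro \<Omega>_restrict) (auto simp: Pi_iff)
  have st: "stored F K M L G W n m l = y m l" if ml: "m < M" "l < L" for m l
  proof -
    have yc: "y m l \<in> carrier F" using y(1)[OF ml(1)] ml by auto
    have "stored F K M L G W n m l = (\<Oplus>k\<in>{..<K}. if k0 = k then y m l \<otimes> inv (G k0 n) \<otimes> G k n else \<zero>)"
      unfolding stored_apply[OF ml] using ml yc Gu G_closed n
      by (intro finsum_cong') (auto simp: W_def)
    also have "\<dots> = y m l \<otimes> inv (G k0 n) \<otimes> G k0 n"
      using k0 yc Gu G_closed n by (intro finsum_singleton) auto
    also have "\<dots> = y m l" using yc Gu by (simp add: m_assoc Units_closed)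
    finally show ?thesis .
  qed
  have "resps i U n W p = z p" if p: "p \<in> coords n" for p
  proof -
    have pX: "p \<in> X" using p by (simp add: coords_def)
    have fin: "finite (files p)" using files(1)[OF pX] by (rule finite_subset) simp
    have mn: "Min (files p) \<in> files p" using fin files(2)[OF pX] by (rule Min_in)
    have "resps i U n W p = resp i U y p"
      using p st y(1) by (auto simp: resps_def intro!: resp_cong[OF U pX])
    also have "\<dots> = (\<Oplus>m\<in>files p. if Min (files p) = m then z p else \<zero>)"
      unfolding resp_def using files(1)[OF pX] y p z
      by (intro finsum_cong') (auto simp: J_def subset_iff)
    also have "\<dots> = z p"
      using fin mn z p by (intro finsum_singleton) auto
    finally show ?thesis .
  qed
  then have "resps i U n W = z"
    using resps_closed[OF U n W] z by (intro PiE_ext[of _ "coords n" "\<lambda>_. carrier F"]) auto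
  then show ?thesis using that W by blast
qed

text \<open>Adding a file tuple with responses \<open>z' - z\<close> carries the fibre over
  \<open>z\<close> into the fibre over \<open>z'\<close>; \<open>resps_surj\<close> provides such a
  tuple.\<close>

lemma resps_uniform:
  assumes U: "U \<in> Us" and i: "i < M" and n: "n < N"
  shows "map_pmf (resps i U n) (pmf_of_set \<Omega>) = pmf_of_set (coords n \<rightarrow>\<^sub>E carrier F)"
proof (rule map_pmf_of_set_fibers[OF finite_\<Omega> \<Omega>_nonempty])
  show "resps i U n ` \<Omega> = coords n \<rightarrow>\<^sub>E carrier F"
    using resps_closed[OF U n] resps_surj[OF U i n] by (auto simp del: PiE_iff) (metis imageI)
  fix z z' assume z: "z \<in> coords n \<rightarrow>\<^sub>E carrier F" "z' \<in> coords n \<rightarrow>\<^sub>E carrier F"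
  have "(\<lambda>p\<in>coords n. z' p \<ominus> z p) \<in> coords n \<rightarrow>\<^sub>E carrier F"
    using z by auto
  then obtain V where V: "V \<in> \<Omega>" "resps i U n V = (\<lambda>p\<in>coords n. z' p \<ominus> z p)"
    by (rule resps_surj[OF U i n])
  let ?t = "\<lambda>W. madd W V"
  have "inj_on ?t \<Omega>"
  proof (rule inj_onI)
    fix W W' assume W: "W \<in> \<Omega>" "W' \<in> \<Omega>" and eq: "?t W = ?t W'"
    have e: "W m l k = W' m l k" if mlk: "m < M" "l < L" "k < K" for m l k
    proof -
      have "W m l k \<oplus> V m l k = W' m l k \<oplus> V m l k"
        using fun_cong[OF fun_cong[OF fun_cong[OF eq, of m], of l], of k] mlk by (simp add: madd_def)
      then show ?thesis using \<Omega>_closed[OF _ mlk] W V by simp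
    qed
    show "W = W'"
    proof (rule PiE_ext[OF W[unfolded file_tuples_def]])
      fix m assume m: "m \<in> {..<M}"
      then have "W m \<in> matrices F L K" "W' m \<in> matrices F L K"
        using W unfolding file_tuples_def by blast+
      then show "W m = W' m" using e m by (intro matrices_ext) auto
    qed
  qed
  moreover have "?t ` \<Omega> \<subseteq> \<Omega>" using madd_closed V by auto
  moreover have "resps i U n (?t W) = z'" if W: "W \<in> \<Omega>" "resps i U n W = z" for W
  proof (rule PiE_ext[OF resps_closed[OF U n madd_closed[OF W(1) V(1)]] z(2)])
    fix p assume p: "p \<in> coords n"
    then have pX: "p \<in> X" by (simp add: coords_def)
    have "resps i U n (?t W) p = resp i U (\<lambda>m l. \<Oplus>k\<in>{..<K}. ?t W m l k \<otimes> G k n) p"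
      using p stored_closed[OF madd_closed[OF W(1) V(1)] n]
      by (auto simp: resps_def stored_apply Pi_iff intro!: resp_cong[OF U pX])
    also have "\<dots> = resps i U n W p \<oplus> resps i U n V p"
      using p by (subst resp_stored_add[OF U pX n W(1) V(1)]) (simp_all add: resps_def madd_def)
    also have "\<dots> = z' p"
      using z p by (auto simp: W V PiE_iff minus_eq a_lcomm r_neg)
    finally show "resps i U n (?t W) p = z' p" .
  qed
  ultimately show "\<exists>t. inj_on t \<Omega> \<and> t ` \<Omega> \<subseteq> \<Omega> \<and> (\<forall>W\<in>\<Omega>. resps i U n W = z \<longrightarrow> resps i U n (t W) = z')"
    by blast
qed

lemma file_uniform:
  assumes i: "i < M"
  shows "map_pmf (\<lambda>W. W i) (pmf_of_set \<Omega>) = pmf_of_set (matrices F L K)"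
proof (rule map_pmf_of_set_fibers[OF finite_\<Omega> \<Omega>_nonempty])
  have ne: "\<Omega> \<noteq> {}" by (rule \<Omega>_nonempty)
  show "(\<lambda>W. W i) ` \<Omega> = matrices F L K"
  proof (intro equalityI subsetI)
    fix x assume x: "x \<in> matrices F L K"
    obtain W where "W \<in> \<Omega>" using ne by auto
    then have "W(i := x) \<in> \<Omega>" using x i by (auto simp: file_tuples_def PiE_iff extensional_def)
    then show "x \<in> (\<lambda>W. W i) ` \<Omega>" by (intro image_eqI[of _ _ "W(i := x)"]) simp_all
  qed (use i in \<open>auto simp: file_tuples_def\<close>)
  fix y y' assume y: "y \<in> matrices F L K" "y' \<in> matrices F L K"
  \<comment> \<open>A transposition rather than a constant map to \<open>y'\<close>, to keep the
    self-map injective.\<close>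
  let ?s = "\<lambda>x. if x = y then y' else if x = y' then y else x"
  let ?t = "\<lambda>W. W(i := ?s (W i))"
  have "inj_on ?t \<Omega>"
  proof (rule inj_onI)
    fix W W' assume eq: "?t W = ?t W'"
    have "?s (W i) = ?s (W' i)" using fun_cong[OF eq, of i] by simp
    then have "W i = W' i" by (auto split: if_splits)
    moreover have "W m = W' m" if "m \<noteq> i" for m using fun_cong[OF eq, of m] that by simp
    ultimately show "W = W'" by (metis ext)
  qed
  moreover have "?t ` \<Omega> \<subseteq> \<Omega>"
  proof (rule image_subsetI)
    fix W assume W: "W \<in> \<Omega>"
    then have "?s (W i) \<in> matrices F L K" using y i by (auto simp: file_tuples_def)
    then have "?t W \<in> insert i {..<M} \<rightarrow>\<^sub>E matrices F L K"
      using W unfolding file_tuples_def by (rule PiE_fun_upd)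
    then show "?t W \<in> \<Omega>" using i by (simp add: file_tuples_def insert_absorb)
  qed
  moreover have "\<forall>W\<in>\<Omega>. W i = y \<longrightarrow> ?t W i = y'" by simp
  ultimately show "\<exists>t. inj_on t \<Omega> \<and> t ` \<Omega> \<subseteq> \<Omega> \<and> (\<forall>W\<in>\<Omega>. W i = y \<longrightarrow> t W i = y')"
    by blast
qed

section \<open>The scheme, encoded in natural numbers\<close>

definition qslots :: "nat \<Rightarrow> ('x \<times> nat) set" where
  "qslots n = (SIGMA p : coords n. files p)"

definition qspace :: "nat \<Rightarrow> ('x \<times> nat \<Rightarrow> nat \<Rightarrow> 'a) set" where
  "qspace n = qslots n \<rightarrow>\<^sub>E ({..<L} \<rightarrow>\<^sub>E carrier F)"

definition aspace :: "nat \<Rightarrow> ('x \<Rightarrow> 'a) set" where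
  "aspace n = coords n \<rightarrow>\<^sub>E carrier F"

text \<open>The user's randomness \<open>f\<close> is the number of a tuple of invertible matrices.
  The query consists of the vectors for all coordinates held by server \<open>n\<close>, and its
  number is taken within the finite set \<open>qspace n\<close>.\<close>

definition qenc :: "nat \<Rightarrow> nat \<Rightarrow> nat \<Rightarrow> nat" where
  "qenc i f n = to_nat_on (qspace n)
     (\<lambda>(p, m)\<in>qslots n. qvec i (from_nat_into Us f) m p)"

definition aenc :: "nat \<Rightarrow> nat \<Rightarrow> (nat \<Rightarrow> nat \<Rightarrow> 'a) \<Rightarrow> nat" where
  "aenc n q y = to_nat_on (aspace n)
     (\<lambda>p\<in>coords n. \<Oplus>m\<in>files p. dot {..<L} (from_nat_into (qspace n) q (p, m)) (y m))"

text \<open>The decoder searches for any file tuple and any candidate Byzantine set that explain the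
  answers. It is not an algorithm; uniqueness of the wanted file among all explanations makes the
  choice harmless. The servers' randomness is deterministic.\<close>

definition scheme :: "(nat, nat, nat, nat, 'a) pir" where
  "scheme = \<lparr>user_rand = map_pmf (to_nat_on Us) (pmf_of_set Us),
     server_rand = return_pmf 0,
     query = qenc,
     alphabet = (\<lambda>n. to_nat_on (aspace n) ` aspace n),
     answer = (\<lambda>n q g y. aenc n q y),
     decode = (\<lambda>i qs a f g. SOME w. \<exists>W\<in>\<Omega>. \<exists>C\<subseteq>{..<N}. card C = B \<and>
        (\<forall>n\<in>{..<N} - C. a n = aenc n (qenc i f n) (stored F K M L G W n)) \<and> w = W i)\<rparr>"

lemma finite_Us: "finite Us" and Us_nonempty: "Us \<noteq> {}"
  using finite_gl[OF finF] gl_nonempty[OF finF] by (auto simp: PiE_eq_empty_iff intro!: finite_PiE)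

lemma from_nat_into_Us: "U \<in> Us \<Longrightarrow> from_nat_into Us (to_nat_on Us U) = U"
  using finite_Us by (intro from_nat_into_to_nat_on) (auto intro: countable_finite)

lemma set_user_rand: "set_pmf (user_rand scheme) = to_nat_on Us ` Us"
  using finite_Us Us_nonempty by (simp add: scheme_def)

lemma finite_qspace: "finite (qspace n)"
proof -
  have "finite (files p)" if "p \<in> coords n" for p
    using files(1)[of p] that by (auto simp: coords_def intro: finite_subset)
  then show ?thesis
    unfolding qspace_def qslots_def using finF finite_coords by (intro finite_PiE finite_SigmaI) auto
qed

lemma finite_aspace: "finite (aspace n)"
  unfolding aspace_def using finF finite_coords by (intro finite_PiE) auto

lemma aenc_qenc:
  assumes "U \<in> Us" and W: "W \<in> \<Omega>" and n: "n < N"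
  shows "aenc n (qenc i (to_nat_on Us U) n) (stored F K M L G W n) = to_nat_on (aspace n) (resps i U n W)"
proof -
  have q: "(\<lambda>(p, m)\<in>qslots n. qvec i U m p) \<in> qspace n"
    unfolding qspace_def
  proof (rule restrict_PiE_iff[THEN iffD2], rule ballI)
    fix s assume "s \<in> qslots n"
    then obtain p m where "s = (p, m)" "p \<in> X" "m \<in> files p"
      by (auto simp: qslots_def coords_def)
    then show "(case s of (p, m) \<Rightarrow> qvec i U m p) \<in> {..<L} \<rightarrow>\<^sub>E carrier F"
      using qvec_closed[OF assms(1), of m p i] files(1)[of p] by (simp add: subset_iff)
  qed
  have "from_nat_into (qspace n) (qenc i (to_nat_on Us U) n) = (\<lambda>(p, m)\<in>qslots n. qvec i U m p)"
    unfolding qenc_def from_nat_into_Us[OF assms(1)]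
    using q finite_qspace by (intro from_nat_into_to_nat_on) (auto intro: countable_finite)
  then have "from_nat_into (qspace n) (qenc i (to_nat_on Us U) n) (p, m) = qvec i U m p"
    if "p \<in> coords n" "m \<in> files p" for p m
    using that by (simp add: qslots_def)
  then have eq: "(\<Oplus>m\<in>files p. dot {..<L} (from_nat_into (qspace n) (qenc i (to_nat_on Us U) n) (p, m))
       (stored F K M L G W n m)) = resp i U (stored F K M L G W n) p" if p: "p \<in> coords n" for p
    unfolding resp_def
  proof (intro finsum_cong' refl funcsetI)
    fix m assume m: "m \<in> files p"
    have pX: "p \<in> X" using p by (simp add: coords_def)
    then have "m < M" using files(1) m by auto
    then show "dot {..<L} (qvec i U m p) (stored F K M L G W n m) \<in> carrier F"
      using qvec_closed[OF assms(1) _ pX] stored_closed[OF W n] by (intro dot_closed) auto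
  qed (simp_all add: p)
  show ?thesis
    unfolding aenc_def resps_def
    by (rule arg_cong[where f = "to_nat_on (aspace n)"], rule restrict_ext, rule eq)
qed

lemma feedbacks_scheme:
  assumes "U \<in> Us" "W \<in> \<Omega>" "n < N"
  shows "feedbacks F K M L G scheme i (to_nat_on Us U, g, W) n = to_nat_on (aspace n) (resps i U n W)"
  using aenc_qenc[OF assms] by (simp add: feedbacks_def scheme_def)

lemma card_carrier: "1 < real (card (carrier F))"
proof -
  have "card {\<zero>, \<one>} \<le> card (carrier F)" using finF by (intro card_mono) auto
  then show ?thesis by simp
qed

section \<open>Privacy\<close>

text \<open>The positions \<sigma> and the map \<open>V\<close>, which reads plain rows of the
  matrices, are chosen before the wanted file. For every \<open>i\<close> the view is
  \<open>V\<close> after a bijection \<tau> of the matrix tuples, and \<tau> preserves the uniform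
  distribution.\<close>

lemma queries_view:
  assumes C: "C \<subseteq> {..<N}" "card C = T"
  shows "\<exists>\<mu>. \<forall>i<M. map_pmf (\<lambda>f. restrict (qenc i f) C) (user_rand scheme) = \<mu>"
proof -
  have "\<exists>\<sigma>. inj_on \<sigma> (seen C m) \<and> \<sigma> ` seen C m \<subseteq> {..<L}" if "m < M" for m
    using card_le_inj[OF finite_seen finite_lessThan, of C m L] card_seen[OF C that] by auto
  then obtain \<sigma> where \<sigma>: "\<And>m. m < M \<Longrightarrow> inj_on (\<sigma> m) (seen C m)" "\<And>m. m < M \<Longrightarrow> \<sigma> m ` seen C m \<subseteq> {..<L}"
    by metis
  define V where "V U = (\<lambda>n\<in>C. to_nat_on (qspace n) (\<lambda>(p, m)\<in>qslots n. U m (\<sigma> m p)))"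
    for U :: "nat \<Rightarrow> nat \<Rightarrow> nat \<Rightarrow> 'a"
  have "map_pmf (\<lambda>f. restrict (qenc i f) C) (user_rand scheme) = map_pmf V (pmf_of_set Us)"
    if i: "i < M" for i
  proof -
    obtain \<tau> where \<tau>: "bij_betw \<tau> Us Us"
      "\<And>U m p. U \<in> Us \<Longrightarrow> m < M \<Longrightarrow> p \<in> seen C m \<Longrightarrow> act L (bv i m p) (U m) = \<tau> U m (\<sigma> m p)"
      by (rule gl_tuple_view_bij[OF finF \<sigma> bv_indep[OF C i] bv_Pi[of "seen C _"]]) (auto simp: seen_def)
    have view: "restrict (qenc i (to_nat_on Us U)) C = V (\<tau> U)" if U: "U \<in> Us" for U
    proof -
      have "(\<lambda>(p, m)\<in>qslots n. qvec i U m p) = (\<lambda>(p, m)\<in>qslots n. \<tau> U m (\<sigma> m p))" if "n \<in> C" for n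
      proof (rule restrict_ext)
        fix s assume "s \<in> qslots n"
        then obtain p m where s: "s = (p, m)" "p \<in> X" "n \<in> srv p" "m \<in> files p"
          by (auto simp: qslots_def coords_def)
        then have "p \<in> seen C m" "m < M" using that files(1)[of p] by (auto simp: seen_def)
        then show "(case s of (p, m) \<Rightarrow> qvec i U m p) = (case s of (p, m) \<Rightarrow> \<tau> U m (\<sigma> m p))"
          using \<tau>(2)[OF U] by (simp add: s qvec_def)
      qed
      then show ?thesis
        unfolding V_def by (intro restrict_ext) (simp add: qenc_def from_nat_into_Us[OF U])
    qed
    have "map_pmf (\<lambda>f. restrict (qenc i f) C) (user_rand scheme)
        = map_pmf (\<lambda>U. restrict (qenc i (to_nat_on Us U)) C) (pmf_of_set Us)"
      by (simp add: scheme_def map_pmf_comp)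
    also have "\<dots> = map_pmf (\<lambda>U. V (\<tau> U)) (pmf_of_set Us)"
      using view finite_Us Us_nonempty by (intro map_pmf_cong) auto
    also have "\<dots> = map_pmf V (map_pmf \<tau> (pmf_of_set Us))"
      by (simp add: map_pmf_comp)
    also have "map_pmf \<tau> (pmf_of_set Us) = pmf_of_set Us"
      by (rule map_pmf_of_set_bij_betw[OF \<tau>(1) Us_nonempty finite_Us])
    finally show ?thesis .
  qed
  then show ?thesis by blast
qed

lemma scheme_private: "pir_private F N K T M L G scheme"
  unfolding pir_private_def
proof (intro allI impI)
  fix P :: "nat pmf" and C assume P: "set_pmf P \<subseteq> {..<M}" and C: "C \<subseteq> {..<N}" "card C = T"
  let ?S = "pir_space F K M L scheme"
  obtain \<mu> where \<mu>: "\<And>i. i < M \<Longrightarrow> map_pmf (\<lambda>f. restrict (qenc i f) C) (user_rand scheme) = \<mu>"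
    using queries_view[OF C] by blast
  let ?R = "pair_pmf (server_rand scheme) (pmf_of_set \<Omega>)"
  \<comment> \<open>The answers of \<open>C\<close> are a fixed function of its queries, the
    servers' randomness and the files, so the law of this triple settles both privacy
    conditions.\<close>
  have joint: "map_pmf (\<lambda>(f, r). (restrict (qenc i f) C, r)) ?S = pair_pmf \<mu> ?R" if "i \<in> set_pmf P" for i
  proof -
    have "map_pmf (\<lambda>(f, r). (restrict (qenc i f) C, r)) ?S
      = pair_pmf (map_pmf (\<lambda>f. restrict (qenc i f) C) (user_rand scheme)) (map_pmf (\<lambda>r. r) ?R)"
      unfolding pir_space_def by (rule map_pair)
    then show ?thesis using \<mu> P that by auto
  qed
  have q: "map_pmf (\<lambda>\<omega>. restrict (queries scheme i \<omega>) C) ?S = map_pmf fst (pair_pmf \<mu> ?R)"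
    if "i \<in> set_pmf P" for i
    unfolding joint[OF that, symmetric] map_pmf_comp
    by (intro map_pmf_cong) (auto simp: queries_def scheme_def)
  have a: "map_pmf (\<lambda>\<omega>. restrict (feedbacks F K M L G scheme i \<omega>) C) ?S
      = map_pmf (\<lambda>(qs, g, W). \<lambda>n\<in>C. aenc n (qs n) (stored F K M L G W n)) (pair_pmf \<mu> ?R)"
    if "i \<in> set_pmf P" for i
    unfolding joint[OF that, symmetric] map_pmf_comp
    by (intro map_pmf_cong) (auto simp: feedbacks_def scheme_def restrict_def fun_eq_iff)
  show "pmf_mutual_information (card (carrier F)) (pair_pmf P ?S) (\<lambda>(i, \<omega>). i)
        (\<lambda>(i, \<omega>). restrict (queries scheme i \<omega>) C) = 0 \<and>
      pmf_mutual_information (card (carrier F)) (pair_pmf P ?S) (\<lambda>(i, \<omega>). i)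
        (\<lambda>(i, \<omega>). restrict (feedbacks F K M L G scheme i \<omega>) C) = 0"
    using pmf_mutual_information_index_eq_0[OF card_carrier q, of P "\<lambda>i. i"]
      pmf_mutual_information_index_eq_0[OF card_carrier a, of P "\<lambda>i. i"] by simp
qed

section \<open>Well-formedness and correctness\<close>

lemma set_pir_space:
  "\<omega> \<in> set_pmf (pir_space F K M L scheme) \<longleftrightarrow> (\<exists>U\<in>Us. \<exists>W\<in>\<Omega>. \<omega> = (to_nat_on Us U, 0, W))"
proof -
  have "set_pmf (server_rand scheme) = {0}" by (simp add: scheme_def)
  then show ?thesis
    using finite_\<Omega> \<Omega>_nonempty by (auto simp: pir_space_def set_user_rand)
qed

lemma scheme_well_formed: "well_formed_pir F N K M L G scheme"
  unfolding well_formed_pir_def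
proof (intro conjI allI impI ballI)
  show "finite (alphabet scheme n)" for n
    using finite_aspace by (simp add: scheme_def)
  fix i assume "i < M"
  show "feedbacks F K M L G scheme i \<omega> n \<in> alphabet scheme n"
    if \<omega>: "\<omega> \<in> set_pmf (pir_space F K M L scheme)" and "n < N" for \<omega> n
  proof -
    obtain U W where U: "U \<in> Us" "W \<in> \<Omega>" "\<omega> = (to_nat_on Us U, 0, W)"
      using \<omega> unfolding set_pir_space by auto
    have "resps i U n W \<in> aspace n"
      using resps_closed[OF U(1) \<open>n < N\<close> U(2)] by (simp add: aspace_def)
    then show ?thesis
      unfolding U(3) feedbacks_scheme[OF U(1,2) \<open>n < N\<close>] by (simp add: scheme_def)
  qed
  have "map_pmf (\<lambda>\<omega>. (restrict (queries scheme i \<omega>) {..<N}, case \<omega> of (f, g, W) \<Rightarrow> W)) (pir_space F K M L scheme)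
      = map_pmf (\<lambda>(f, r). (restrict (qenc i f) {..<N}, snd r)) (pir_space F K M L scheme)"
    by (intro map_pmf_cong) (auto simp: queries_def scheme_def)
  also have "\<dots> = pair_pmf (map_pmf (\<lambda>f. restrict (qenc i f) {..<N}) (user_rand scheme)) (pmf_of_set \<Omega>)"
    unfolding pir_space_def map_pair by (simp add: map_snd_pair_pmf)
  finally have joint: "map_pmf (\<lambda>\<omega>. (restrict (queries scheme i \<omega>) {..<N}, case \<omega> of (f, g, W) \<Rightarrow> W)) (pir_space F K M L scheme)
     = pair_pmf (map_pmf (\<lambda>f. restrict (qenc i f) {..<N}) (user_rand scheme)) (pmf_of_set \<Omega>)" .
  show "pmf_mutual_information (card (carrier F)) (pir_space F K M L scheme)
      (\<lambda>\<omega>. restrict (queries scheme i \<omega>) {..<N}) (\<lambda>(f, g, W). W) = 0"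
  proof (rule pmf_mutual_information_eq_0[OF card_carrier])
    show "map_pmf (\<lambda>\<omega>. (restrict (queries scheme i \<omega>) {..<N}, case \<omega> of (f, g, W) \<Rightarrow> W)) (pir_space F K M L scheme)
      = pair_pmf (map_pmf (\<lambda>\<omega>. restrict (queries scheme i \<omega>) {..<N}) (pir_space F K M L scheme))
         (map_pmf (\<lambda>(f, g, W). W) (pir_space F K M L scheme))"
    proof -
      have "map_pmf (\<lambda>\<omega>. restrict (queries scheme i \<omega>) {..<N}) (pir_space F K M L scheme)
          = map_pmf (\<lambda>f. restrict (qenc i f) {..<N}) (user_rand scheme)"
        using arg_cong[OF joint, of "map_pmf fst"] by (simp add: map_pmf_comp map_fst_pair_pmf)
      moreover have "map_pmf (\<lambda>(f, g, W). W) (pir_space F K M L scheme) = pmf_of_set \<Omega>"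
        using arg_cong[OF joint, of "map_pmf snd"] by (simp add: map_pmf_comp map_snd_pair_pmf)
      ultimately show ?thesis using joint by simp
    qed
  qed
qed

text \<open>The true files with the true Byzantine set are one explanation of the answers. Any other
  explanation agrees with it at all servers outside both Byzantine sets, so
  \<open>wanted_file_unique\<close> applies.\<close>

lemma scheme_correct: "pir_correct F N K M B L G scheme"
  unfolding pir_correct_def
proof (intro allI impI ballI case_prodI2)
  fix i \<omega> f gW g W C a
  assume i: "i < M" and "\<omega> \<in> set_pmf (pir_space F K M L scheme)" "\<omega> = (f, gW)" "gW = (g, W)"
    and C: "C \<subseteq> {..<N}" "card C = B"
    and a: "\<forall>n\<in>{..<N} - C. a n = feedbacks F K M L G scheme i (f, g, W) n"
  then obtain U where U: "U \<in> Us" "W \<in> \<Omega>" "f = to_nat_on Us U"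
    unfolding set_pir_space by auto
  let ?P = "\<lambda>w. \<exists>W\<in>\<Omega>. \<exists>C\<subseteq>{..<N}. card C = B \<and>
     (\<forall>n\<in>{..<N} - C. a n = aenc n (qenc i f n) (stored F K M L G W n)) \<and> w = W i"
  have "\<forall>n\<in>{..<N} - C. a n = aenc n (qenc i f n) (stored F K M L G W n)"
    using a by (simp add: feedbacks_def scheme_def)
  then have ex: "?P (W i)" using U(2) C by auto
  have uniq: "w = W i" if w: "?P w" for w
  proof -
    obtain W' C' where W': "W' \<in> \<Omega>" "C' \<subseteq> {..<N}" "card C' = B" "w = W' i"
      "\<forall>n\<in>{..<N} - C'. a n = aenc n (qenc i f n) (stored F K M L G W' n)"
      using w by auto
    have "W i = W' i"
    proof (rule wanted_file_unique[OF U(1) i U(2) W'(1) C(1) W'(2) C(2) W'(3)])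
      fix n p assume n: "n \<in> {..<N} - (C \<union> C')" and p: "p \<in> coords n"
      have "to_nat_on (aspace n) (resps i U n W) = a n"
        using a n U feedbacks_scheme[OF U(1,2)] by simp
      also have "\<dots> = to_nat_on (aspace n) (resps i U n W')"
        using W'(5) n aenc_qenc[OF U(1) W'(1)] by (simp add: U(3))
      finally have "resps i U n W = resps i U n W'"
        using resps_closed[OF U(1) _ U(2)] resps_closed[OF U(1) _ W'(1)] n finite_aspace
        by (subst (asm) to_nat_on_inj) (auto simp: aspace_def intro: countable_finite)
      from fun_cong[OF this, of p] p
      show "resp i U (stored F K M L G W n) p = resp i U (stored F K M L G W' n) p"
        by (simp add: resps_def)
    qed
    then show ?thesis using W'(4) by simp
  qed
  have "decode scheme i (restrict (queries scheme i (f, g, W)) {..<N}) a f g = (SOME w. ?P w)"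
    by (simp add: scheme_def)
  also have "\<dots> = W i" using ex uniq by (rule some_equality)
  finally show "decode scheme i (restrict (queries scheme i (f, g, W)) {..<N}) a f g = W i" .
qed

section \<open>Entropies and the rate\<close>

text \<open>The answer is uniform for each fixed choice of the matrices, hence also after averaging
  over them.\<close>

lemma entropy_feedback:
  assumes i: "i < M" and n: "n < N"
  shows "pmf_entropy (card (carrier F)) (pir_space F K M L scheme)
     (\<lambda>\<omega>. feedbacks F K M L G scheme i \<omega> n) = card (coords n)"
proof -
  let ?Y = "to_nat_on (aspace n) ` aspace n" and ?S = "pir_space F K M L scheme"
  have ne: "aspace n \<noteq> {}" unfolding aspace_def by (auto simp: PiE_eq_empty_iff)
  have inj: "inj_on (to_nat_on (aspace n)) (aspace n)"
    using finite_aspace by (intro inj_on_to_nat_on countable_finite)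
  have "map_pmf (\<lambda>\<omega>. feedbacks F K M L G scheme i \<omega> n) ?S
      = map_pmf (\<lambda>(U, W). to_nat_on (aspace n) (resps i U n W)) (pair_pmf (pmf_of_set Us) (pmf_of_set \<Omega>))"
  proof -
    have S: "?S = map_pmf (\<lambda>(U, W). (to_nat_on Us U, 0, W)) (pair_pmf (pmf_of_set Us) (pmf_of_set \<Omega>))"
      by (simp add: pir_space_def scheme_def pair_return_pmf1 map_pair)
    show ?thesis
      unfolding S map_pmf_comp
    proof (rule map_pmf_cong[OF refl])
      fix x assume "x \<in> set_pmf (pair_pmf (pmf_of_set Us) (pmf_of_set \<Omega>))"
      then obtain U W where "x = (U, W)" "U \<in> Us" "W \<in> \<Omega>"
        by (simp only: set_pair_pmf set_pmf_of_set[OF Us_nonempty finite_Us]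
            set_pmf_of_set[OF \<Omega>_nonempty finite_\<Omega>]) (rule SigmaE)
      then show "feedbacks F K M L G scheme i (case x of (U, W) \<Rightarrow> (to_nat_on Us U, 0, W)) n
        = (case x of (U, W) \<Rightarrow> to_nat_on (aspace n) (resps i U n W))"
        by (simp only: prod.case feedbacks_scheme[OF _ _ n])
    qed
  qed
  also have "\<dots> = bind_pmf (pmf_of_set Us) (\<lambda>U. map_pmf (to_nat_on (aspace n)) (map_pmf (resps i U n) (pmf_of_set \<Omega>)))"
    by (simp add: pair_pmf_def map_bind_pmf map_pmf_comp)
      (simp add: map_pmf_def)
  also have "\<dots> = bind_pmf (pmf_of_set Us) (\<lambda>U. pmf_of_set ?Y)"
  proof (intro bind_pmf_cong refl)
    fix U assume "U \<in> set_pmf (pmf_of_set Us)"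
    then have "U \<in> Us" by (simp only: set_pmf_of_set[OF Us_nonempty finite_Us])
    then show "map_pmf (to_nat_on (aspace n)) (map_pmf (resps i U n) (pmf_of_set \<Omega>)) = pmf_of_set ?Y"
      by (simp only: resps_uniform[OF _ i n] aspace_def[symmetric]
          map_pmf_of_set_inj[OF inj ne finite_aspace])
  qed
  finally have "map_pmf (\<lambda>\<omega>. feedbacks F K M L G scheme i \<omega> n) ?S = pmf_of_set ?Y" by simp
  then have "pmf_entropy (card (carrier F)) ?S (\<lambda>\<omega>. feedbacks F K M L G scheme i \<omega> n)
      = log (card (carrier F)) (card ?Y)"
    using finite_aspace ne by (intro pmf_entropy_uniform[OF card_carrier]) auto
  also have "card ?Y = card (carrier F) ^ card (coords n)"
    using card_image[OF inj] finite_coords by (simp add: aspace_def card_PiE)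
  finally show ?thesis using card_carrier by (simp add: log_nat_power)
qed

lemma entropy_file:
  assumes i: "i < M"
  shows "pmf_entropy (card (carrier F)) (pir_space F K M L scheme) (\<lambda>(f, g, W). W i) = L * K"
proof -
  let ?S = "pir_space F K M L scheme"
  have "map_pmf (\<lambda>(f, g, W). W i) ?S = map_pmf (\<lambda>W. W i) (map_pmf snd (map_pmf snd ?S))"
    by (simp add: map_pmf_comp case_prod_unfold)
  also have "\<dots> = pmf_of_set (matrices F L K)"
    by (simp add: pir_space_def map_snd_pair_pmf file_uniform[OF i])
  finally have "pmf_entropy (card (carrier F)) ?S (\<lambda>(f, g, W). W i)
      = log (card (carrier F)) (card (matrices F L K))"
    using finF by (intro pmf_entropy_uniform[OF card_carrier])
      (auto simp: matrices_def PiE_eq_empty_iff intro!: finite_PiE)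
  also have "card (matrices F L K) = card (carrier F) ^ (L * K)"
    by (simp add: matrices_def card_PiE power_mult mult.commute)
  finally show ?thesis using card_carrier by (simp add: log_nat_power)
qed

text \<open>Double counting of pairs of a server and a coordinate. The factor \<open>K\<close>
  cancels against the \<open>K\<close> symbols in each row of a file.\<close>

lemma sum_card_coords: "(\<Sum>n<N. card (coords n)) = K * card X"
proof -
  have "(\<Sum>n<N. card (coords n)) = (\<Sum>n\<in>{..<N}. \<Sum>p\<in>X. if n \<in> srv p then 1 else 0)"
    using finX by (simp add: coords_def sum.If_cases Int_def)
  also have "\<dots> = (\<Sum>p\<in>X. \<Sum>n\<in>{..<N}. if n \<in> srv p then 1 else 0)"
    by (rule sum.swap)
  also have "\<dots> = (\<Sum>p\<in>X. K)"
  proof (intro sum.cong refl)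
    fix p assume p: "p \<in> X"
    then have "{..<N} \<inter> srv p = srv p" using srv(1) by blast
    then show "(\<Sum>n\<in>{..<N}. if n \<in> srv p then 1 else 0) = K"
      using srv(2)[OF p] by (simp add: sum.If_cases Int_def[symmetric] Collect_mem_eq)
  qed
  finally show ?thesis by (simp add: mult.commute)
qed

theorem scheme_properties:
  "byzantine_pir_scheme F N K T M B L G scheme"
  "i < M \<Longrightarrow> pir_rate F N K M L G scheme i = real L / real (card X)"
proof -
  show "byzantine_pir_scheme F N K T M B L G scheme"
    unfolding byzantine_pir_scheme_def
    using scheme_well_formed scheme_correct scheme_private by blast
  assume i: "i < M"
  have "(\<Sum>n<N. pmf_entropy (card (carrier F)) (pir_space F K M L scheme)
      (\<lambda>\<omega>. feedbacks F K M L G scheme i \<omega> n)) = real (\<Sum>n<N. card (coords n))"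
    using entropy_feedback[OF i] by simp
  then have "pir_rate F N K M L G scheme i = real (L * K) / real (K * card X)"
    unfolding pir_rate_def entropy_file[OF i] sum_card_coords by simp
  then show "pir_rate F N K M L G scheme i = real L / real (card X)"
    using K by (simp add: field_simps)
qed

end


section \<open>Counting coordinates\<close>

text \<open>The binomial theorem, expanded over subsets.\<close>

lemma sum_Pow_power_card:
  fixes a b :: nat
  assumes "finite A"
  shows "(\<Sum>\<Gamma>\<in>Pow A. a ^ card \<Gamma> * b ^ (card A - card \<Gamma>)) = (a + b) ^ card A"
proof -
  have "(a + b) ^ card A = (\<Prod>i\<in>A. a + b)" by simp
  also have "\<dots> = (\<Sum>\<Gamma>\<in>Pow A. (\<Prod>i\<in>\<Gamma>. a) * (\<Prod>i\<in>A - \<Gamma>. b))"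
    using assms by (rule prod_add)
  also have "\<dots> = (\<Sum>\<Gamma>\<in>Pow A. a ^ card \<Gamma> * b ^ (card A - card \<Gamma>))"
    using assms by (intro sum.cong refl) (auto simp: card_Diff_subset finite_subset)
  finally show ?thesis by simp
qed

text \<open>For each set of \<open>s\<close> files the scheme uses \<open>blocks M D I s\<close> blocks; the numbers are chosen such
  that interference is protected by a code of length \<open>blocks M D I s + blocks M D I (s + 1)\<close> blocks
  of which any \<open>T\<close> servers see exactly an information set.\<close>

definition blocks :: "nat \<Rightarrow> nat \<Rightarrow> nat \<Rightarrow> nat \<Rightarrow> nat" where
  "blocks M D I s = (D - I) ^ (s - 1) * I ^ (M - s)"

text \<open>Left: the coordinates seen by \<open>T\<close> servers in the blocks of a set of
  \<open>s\<close> files and of that set with one more file. Right: the dimension of their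
  interference code. It amounts to the recursion with ratio \<open>(D - I) / I\<close>.\<close>

lemma blocks_Suc:
  assumes "I \<le> D" "1 \<le> s" "s < M"
  shows "(blocks M D I s + blocks M D I (Suc s)) * I = D * blocks M D I s"
proof -
  obtain r where s: "s = Suc r" using assms by (cases s) auto
  have "I * I ^ (M - Suc s) = I ^ (M - s)"
    using assms by (simp flip: power_Suc add: Suc_diff_Suc)
  then have "blocks M D I (Suc s) * I = (D - I) * blocks M D I s"
    unfolding blocks_def by (simp add: s ac_simps)
  then have "(blocks M D I s + blocks M D I (Suc s)) * I = (I + (D - I)) * blocks M D I s"
    by (simp add: algebra_simps)
  then show ?thesis using assms by simp
qed

text \<open>Deleting \<open>i\<close> from each set turns this into the binomial expansion of
  \<open>((D - I) + I) ^ (M - 1)\<close>.\<close>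

lemma sum_blocks_containing:
  assumes "I \<le> D" "i < M"
  shows "(\<Sum>\<Gamma> | \<Gamma> \<subseteq> {..<M} \<and> i \<in> \<Gamma>. blocks M D I (card \<Gamma>)) = D ^ (M - 1)"
proof -
  let ?A = "{..<M} - {i}"
  have A: "finite ?A" "card ?A = M - 1" using assms by auto
  have "(\<Sum>\<Gamma> | \<Gamma> \<subseteq> {..<M} \<and> i \<in> \<Gamma>. blocks M D I (card \<Gamma>))
      = (\<Sum>\<Gamma>\<in>Pow ?A. (D - I) ^ card \<Gamma> * I ^ (card ?A - card \<Gamma>))"
  proof (rule sum.reindex_bij_witness[of _ "insert i" "\<lambda>\<Gamma>. \<Gamma> - {i}"])
    fix \<Gamma> assume "\<Gamma> \<in> {\<Gamma>. \<Gamma> \<subseteq> {..<M} \<and> i \<in> \<Gamma>}"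
    then have \<Gamma>: "\<Gamma> \<subseteq> {..<M}" "i \<in> \<Gamma>" "finite \<Gamma>" by (auto intro: finite_subset)
    then have "card \<Gamma> > 0" by (auto simp: card_gt_0_iff)
    then show "(D - I) ^ card (\<Gamma> - {i}) * I ^ (card ?A - card (\<Gamma> - {i})) = blocks M D I (card \<Gamma>)"
      using \<Gamma> unfolding A blocks_def by (simp add: card_Diff_singleton)
  qed (use assms in auto)
  also have "\<dots> = (D - I + I) ^ card ?A" by (rule sum_Pow_power_card[OF A(1)])
  finally show ?thesis using assms A by simp
qed

text \<open>The factor \<open>D - I\<close> restores the exponent \<open>card \<Gamma>\<close>, and
  \<open>I ^ M\<close> is the missing term of the empty set.\<close>

lemma sum_blocks:
  assumes "I \<le> D"
  shows "(D - I) * (\<Sum>\<Gamma>\<in>Pow {..<M} - {{}}. blocks M D I (card \<Gamma>)) + I ^ M = D ^ M"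
proof -
  have "(D - I) * (\<Sum>\<Gamma>\<in>Pow {..<M} - {{}}. blocks M D I (card \<Gamma>))
      = (\<Sum>\<Gamma>\<in>Pow {..<M} - {{}}. (D - I) ^ card \<Gamma> * I ^ (card {..<M} - card \<Gamma>))"
    unfolding sum_distrib_left
  proof (intro sum.cong refl)
    fix \<Gamma> assume "\<Gamma> \<in> Pow {..<M} - {{}}"
    then have "card \<Gamma> \<noteq> 0" by (auto simp: card_eq_0_iff dest: finite_subset)
    then obtain r where "card \<Gamma> = Suc r" by (cases "card \<Gamma>") auto
    then show "(D - I) * blocks M D I (card \<Gamma>) = (D - I) ^ card \<Gamma> * I ^ (card {..<M} - card \<Gamma>)"
      by (simp add: blocks_def)
  qed
  moreover have "(\<Sum>\<Gamma>\<in>Pow {..<M}. (D - I) ^ card \<Gamma> * I ^ (card {..<M} - card \<Gamma>))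
      = (\<Sum>\<Gamma>\<in>Pow {..<M} - {{}}. (D - I) ^ card \<Gamma> * I ^ (card {..<M} - card \<Gamma>)) + I ^ M"
    by (subst sum.remove[of _ "{}"]) auto
  ultimately show ?thesis
    using sum_Pow_power_card[of "{..<M}" "D - I" I] assms by simp
qed

section \<open>Sets of \<open>K\<close> servers and the coordinates built from them\<close>

definition ksets :: "nat \<Rightarrow> nat \<Rightarrow> nat set set" where
  "ksets N K = {S. S \<subseteq> {..<N} \<and> card S = K}"

lemma finite_ksets: "finite (ksets N K)"
  unfolding ksets_def by (rule finite_subset[of _ "Pow {..<N}"]) auto

lemma card_ksets: "card (ksets N K) = N choose K"
  unfolding ksets_def using n_subsets[of "{..<N}" K] by simp

lemma card_ksets_meeting:
  assumes "C \<subseteq> {..<N}"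
  shows "card {S \<in> ksets N K. S \<inter> C \<noteq> {}} = (N choose K) - ((N - card C) choose K)"
proof -
  have fin: "finite C" using assms by (rule finite_subset) simp
  have "{S \<in> ksets N K. S \<inter> C \<noteq> {}} = ksets N K - {S. S \<subseteq> {..<N} - C \<and> card S = K}"
    by (auto simp: ksets_def)
  moreover have "card {S. S \<subseteq> {..<N} - C \<and> card S = K} = (N - card C) choose K"
    using n_subsets[of "{..<N} - C" K] assms fin by (simp add: card_Diff_subset)
  moreover have "{S. S \<subseteq> {..<N} - C \<and> card S = K} \<subseteq> ksets N K" by (auto simp: ksets_def)
  ultimately show ?thesis
    using finite_ksets by (simp add: card_Diff_subset card_ksets finite_subset)
qed

text \<open>Union bound over the two candidate Byzantine sets; this is the origin of the constant
  \<open>D\<close>.\<close>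

lemma card_ksets_avoiding_two:
  assumes C: "C \<subseteq> {..<N}" "C' \<subseteq> {..<N}" "card C = B" "card C' = B"
  shows "2 * ((N - B) choose K) - (N choose K) \<le> card {S \<in> ksets N K. S \<inter> (C \<union> C') = {}}"
proof -
  let ?m = "\<lambda>C. {S \<in> ksets N K. S \<inter> C \<noteq> {}}"
  let ?a = "{S \<in> ksets N K. S \<inter> (C \<union> C') = {}}"
  have "ksets N K = ?a \<union> (?m C \<union> ?m C')" by auto
  then have "N choose K \<le> card ?a + card (?m C \<union> ?m C')"
    using card_Un_le[of ?a "?m C \<union> ?m C'"] by (simp add: card_ksets[symmetric])
  also have "\<dots> \<le> card ?a + (card (?m C) + card (?m C'))"
    using card_Un_le by (intro add_left_mono)
  finally have "N choose K \<le> card ?a + 2 * ((N choose K) - ((N - B) choose K))"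
    using card_ksets_meeting[OF C(1), of K] card_ksets_meeting[OF C(2), of K] C by simp
  moreover have "(N - B) choose K \<le> N choose K" by (rule binomial_right_mono) simp
  ultimately show ?thesis by linarith
qed

text \<open>A coordinate is a set of files, the number of a block for that set, and a
  \<open>K\<close>-set of servers.\<close>

definition coordinates :: "nat \<Rightarrow> nat \<Rightarrow> nat \<Rightarrow> nat \<Rightarrow> nat \<Rightarrow> (nat set \<times> nat \<times> nat set) set" where
  "coordinates M N K D I =
     (SIGMA \<Gamma> : Pow {..<M} - {{}}. {..<blocks M D I (card \<Gamma>)} \<times> ksets N K)"

lemma finite_coordinates: "finite (coordinates M N K D I)"
  unfolding coordinates_def using finite_ksets by (intro finite_SigmaI) auto

lemma coordinatesD:
  assumes "p \<in> coordinates M N K D I"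
  shows "fst p \<subseteq> {..<M}" "fst p \<noteq> {}" "snd (snd p) \<subseteq> {..<N}" "card (snd (snd p)) = K"
  using assms by (auto simp: coordinates_def ksets_def)

lemma card_coordinates_restrict:
  assumes "A \<subseteq> Pow {..<M} - {{}}"
  shows "card {p \<in> coordinates M N K D I. fst p \<in> A \<and> P (snd (snd p))}
    = (\<Sum>\<Gamma>\<in>A. blocks M D I (card \<Gamma>)) * card {S \<in> ksets N K. P S}"
proof -
  have "{p \<in> coordinates M N K D I. fst p \<in> A \<and> P (snd (snd p))}
     = (SIGMA \<Gamma> : A. {..<blocks M D I (card \<Gamma>)} \<times> {S \<in> ksets N K. P S})"
    using assms by (auto simp: coordinates_def)
  moreover have "finite A" using assms by (rule finite_subset) simp
  ultimately show ?thesis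
    using finite_ksets by (simp add: card_SigmaI card_cartesian_product sum_distrib_right)
qed

lemma card_coordinates:
  "card (coordinates M N K D I) = (\<Sum>\<Gamma>\<in>Pow {..<M} - {{}}. blocks M D I (card \<Gamma>)) * (N choose K)"
proof -
  have "coordinates M N K D I = {p \<in> coordinates M N K D I. fst p \<in> Pow {..<M} - {{}} \<and> True}"
    by (auto simp: coordinates_def)
  then show ?thesis
    using card_coordinates_restrict[of "Pow {..<M} - {{}}" M N K D I "\<lambda>_. True"]
    by (simp add: card_ksets)
qed

lemma interval_partition_exists:
  fixes \<A> :: "nat set set" and d :: "nat set \<Rightarrow> nat"
  assumes "finite \<A>" "{} \<notin> \<A>" "sum d \<A> \<le> L"
  shows "\<exists>g. \<forall>\<Gamma>\<in>\<A>. bij_betw (\<lambda>l. snd (g l)) {l. l < L \<and> fst (g l) = \<Gamma>} {..<d \<Gamma>}"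
proof -
  let ?E = "SIGMA \<Gamma> : \<A>. {..<d \<Gamma>}"
  have finE: "finite ?E" using assms by (intro finite_SigmaI) auto
  have "card ?E \<le> card {..<L}" using assms by (simp add: card_SigmaI)
  then obtain \<beta> where \<beta>: "\<beta> ` ?E \<subseteq> {..<L}" "inj_on \<beta> ?E"
    using card_le_inj[OF finE finite_lessThan] by blast
  \<comment> \<open>Rows outside the image are labelled by the empty set, which is not a member of
    \<open>\<A>\<close>, so they belong to no code.\<close>
  define g where "g l = (if l \<in> \<beta> ` ?E then inv_into ?E \<beta> l else ({}, 0))" for l
  have g\<beta>: "g (\<beta> e) = e" if "e \<in> ?E" for e using \<beta>(2) that by (simp add: g_def)
  have "bij_betw (\<lambda>l. snd (g l)) {l. l < L \<and> fst (g l) = \<Gamma>} {..<d \<Gamma>}" if \<Gamma>: "\<Gamma> \<in> \<A>" for \<Gamma>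
  proof (rule bij_betw_byWitness[where f' = "\<lambda>j. \<beta> (\<Gamma>, j)"])
    have lE: "\<exists>j. j < d \<Gamma> \<and> l = \<beta> (\<Gamma>, j)" if "fst (g l) = \<Gamma>" for l
    proof -
      have "l \<in> \<beta> ` ?E" using that \<Gamma> assms(2) by (auto simp: g_def split: if_splits)
      then obtain e where e: "e \<in> ?E" "l = \<beta> e" by blast
      then have "fst e = \<Gamma>" using that g\<beta> by simp
      then show ?thesis using e by (cases e) auto
    qed
    have jE: "(\<Gamma>, j) \<in> ?E" if "j < d \<Gamma>" for j using \<Gamma> that by simp
    show "\<forall>l\<in>{l. l < L \<and> fst (g l) = \<Gamma>}. \<beta> (\<Gamma>, snd (g l)) = l"
      using lE g\<beta>[OF jE] by fastforce
    show "\<forall>j\<in>{..<d \<Gamma>}. snd (g (\<beta> (\<Gamma>, j))) = j"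
      using g\<beta>[OF jE] by simp
    show "(\<lambda>l. snd (g l)) ` {l. l < L \<and> fst (g l) = \<Gamma>} \<subseteq> {..<d \<Gamma>}"
    proof (rule image_subsetI)
      fix l assume "l \<in> {l. l < L \<and> fst (g l) = \<Gamma>}"
      then obtain j where "j < d \<Gamma>" "l = \<beta> (\<Gamma>, j)" using lE by blast
      then show "snd (g l) \<in> {..<d \<Gamma>}" using g\<beta>[OF jE] by simp
    qed
    show "(\<lambda>j. \<beta> (\<Gamma>, j)) ` {..<d \<Gamma>} \<subseteq> {l. l < L \<and> fst (g l) = \<Gamma>}"
      using g\<beta>[OF jE] \<beta>(1) jE by (auto simp: image_subset_iff)
  qed
  then show ?thesis by blast
qed

section \<open>Choice of parameters and the resulting rate\<close>

lemma pir_scheme_exists: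
  fixes F :: "'a ring"
  assumes "1 \<le> K" "1 \<le> T" "1 \<le> M" "T \<le> N" "K \<le> N"
    and D: "D = 2 * ((N - B) choose K) - (N choose K)"
    and I: "I = (N choose K) - ((N - T) choose K)" and ID: "I < D"
    and F: "field F" "finite (carrier F)" "card (coordinates M N K D I) \<le> card (carrier F)"
    and G: "mds_matrix F N K G"
  shows "\<exists>S :: (nat, nat, nat, nat, 'a) pir. byzantine_pir_scheme F N K T M B (D ^ M) G S \<and>
     (\<forall>i<M. pir_rate F N K M (D ^ M) G S i = real (D ^ M) / real (card (coordinates M N K D I)))"
proof -
  let ?X = "coordinates M N K D I" and ?L = "D ^ M" and ?d = "\<lambda>\<Gamma>. D * blocks M D I (card \<Gamma>)"
  have L: "?L = D * D ^ (M - 1)" using \<open>1 \<le> M\<close> by (simp flip: power_Suc)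
  obtain pt where pt: "pt ` ?X \<subseteq> carrier F" "inj_on pt ?X"
    using card_le_inj[OF finite_coordinates F(2,3)] by blast
  define is_index :: "nat \<Rightarrow> nat \<Rightarrow> (nat \<Rightarrow> nat set \<times> nat) \<Rightarrow> bool" where
    "is_index i m g \<longleftrightarrow> (\<forall>\<Gamma>\<in>{\<Gamma>. \<Gamma> \<subseteq> {..<M} - {i} \<and> m \<in> \<Gamma>}.
      bij_betw (\<lambda>l. snd (g l)) {l. l < ?L \<and> fst (g l) = \<Gamma>} {..<?d \<Gamma>})" for i m g
  have index: "\<exists>g. is_index i m g" if m: "m < M" for i m
  proof -
    let ?A = "{\<Gamma>. \<Gamma> \<subseteq> {..<M} - {i} \<and> m \<in> \<Gamma>}"
    have fin: "finite {\<Gamma>. \<Gamma> \<subseteq> {..<M} \<and> m \<in> \<Gamma>}" by (rule finite_subset[of _ "Pow {..<M}"]) auto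
    \<comment> \<open>The codes of file \<open>m\<close> need disjoint sets of rows. Even with the
      groups containing \<open>i\<close> included, the dimensions add up to only
      \<open>D * D ^ (M - 1) = L\<close>.\<close>
    have "sum ?d ?A \<le> sum ?d {\<Gamma>. \<Gamma> \<subseteq> {..<M} \<and> m \<in> \<Gamma>}"
      using fin by (intro sum_mono2) auto
    also have "\<dots> = ?L"
      using sum_blocks_containing[of I D m M] ID m L by (simp flip: sum_distrib_left)
    finally have "sum ?d ?A \<le> ?L" .
    moreover have "finite ?A" using fin by (rule rev_finite_subset) auto
    ultimately show ?thesis
      using interval_partition_exists[of ?A ?d ?L] unfolding is_index_def by blast
  qed
  define \<gamma> where "\<gamma> i m = (SOME g. is_index i m g)" for i m
  have \<gamma>: "bij_betw (\<lambda>l. snd (\<gamma> i m l)) {l. l < ?L \<and> fst (\<gamma> i m l) = \<Gamma>} {..<?d \<Gamma>}"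
    if "m < M" "\<Gamma> \<subseteq> {..<M} - {i}" "m \<in> \<Gamma>" for i m \<Gamma>
  proof -
    have "is_index i m (\<gamma> i m)" unfolding \<gamma>_def by (rule someI_ex[OF index[OF that(1)]])
    then show ?thesis using that(2,3) by (simp add: is_index_def)
  qed
  interpret field F by (rule F(1))
  interpret pir_design F N K T M B ?L G ?X fst "\<lambda>p. snd (snd p)" pt ?d \<gamma>
  proof (rule pir_design.intro[OF F(1)], rule pir_design_axioms.intro, goal_cases)
    \<comment> \<open>Cases 14 to 18 are \<gamma>, the two privacy counts and the two decoding
      counts. Per block, \<open>T\<close> servers see \<open>I\<close> coordinates, and at least
      \<open>D\<close> are clean.\<close>
    case (14 i m \<Gamma>)
    then show ?case by (intro \<gamma>) auto
  next
    case (15 C i)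
    let ?A = "{\<Gamma>. \<Gamma> \<subseteq> {..<M} \<and> i \<in> \<Gamma>}"
    have "{p \<in> ?X. i \<in> fst p \<and> snd (snd p) \<inter> C \<noteq> {}} = {p \<in> ?X. fst p \<in> ?A \<and> snd (snd p) \<inter> C \<noteq> {}}"
      by (auto simp: coordinates_def)
    moreover have "?A \<subseteq> Pow {..<M} - {{}}" by auto
    ultimately have "card {p \<in> ?X. i \<in> fst p \<and> snd (snd p) \<inter> C \<noteq> {}} = D ^ (M - 1) * I"
      using card_coordinates_restrict[of ?A M N K D I "\<lambda>S. S \<inter> C \<noteq> {}"]
        sum_blocks_containing[of I D i M] ID 15 card_ksets_meeting[of C N K] by (simp add: I)
    then show ?case using ID unfolding L by simp
  next
    case (16 C i \<Gamma>)
    let ?A = "{\<Gamma>, insert i \<Gamma>}"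
    have fin: "finite \<Gamma>" using 16 by (auto intro: finite_subset)
    have i: "i \<notin> \<Gamma>" using 16 by auto
    have "card \<Gamma> \<le> card ({..<M} - {i})" using 16 by (intro card_mono) auto
    then have s: "1 \<le> card \<Gamma>" "card \<Gamma> < M" using 16 fin by (auto simp: Suc_le_eq card_gt_0_iff)
    have "{p \<in> ?X. fst p - {i} = \<Gamma> \<and> snd (snd p) \<inter> C \<noteq> {}} = {p \<in> ?X. fst p \<in> ?A \<and> snd (snd p) \<inter> C \<noteq> {}}"
      using i by auto
    moreover have "?A \<subseteq> Pow {..<M} - {{}}" using 16 by auto
    moreover have "\<Gamma> \<noteq> insert i \<Gamma>" using i by auto
    ultimately have "card {p \<in> ?X. fst p - {i} = \<Gamma> \<and> snd (snd p) \<inter> C \<noteq> {}}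
        = (blocks M D I (card \<Gamma>) + blocks M D I (Suc (card \<Gamma>))) * I"
      using card_coordinates_restrict[of ?A M N K D I "\<lambda>S. S \<inter> C \<noteq> {}"]
        16 card_ksets_meeting[of C N K] fin i by (simp add: I)
    \<comment> \<open>Here equality holds: the number of coordinates seen is exactly the
      dimension.\<close>
    then show ?case using blocks_Suc[of I D "card \<Gamma>" M] ID s by simp
  next
    case (17 C C' i)
    let ?A = "{\<Gamma>. \<Gamma> \<subseteq> {..<M} \<and> i \<in> \<Gamma>}"
    have "{p \<in> ?X. i \<in> fst p \<and> snd (snd p) \<inter> (C \<union> C') = {}}
        = {p \<in> ?X. fst p \<in> ?A \<and> snd (snd p) \<inter> (C \<union> C') = {}}"
      by (auto simp: coordinates_def)
    moreover have "?A \<subseteq> Pow {..<M} - {{}}" by auto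
    ultimately have "card {p \<in> ?X. i \<in> fst p \<and> snd (snd p) \<inter> (C \<union> C') = {}}
        = D ^ (M - 1) * card {S \<in> ksets N K. S \<inter> (C \<union> C') = {}}"
      using card_coordinates_restrict[of ?A M N K D I "\<lambda>S. S \<inter> (C \<union> C') = {}"]
        sum_blocks_containing[of I D i M] ID 17 by simp
    then show ?case
      using card_ksets_avoiding_two[OF 17(1-4), of K] unfolding L by (simp add: D)
  next
    case (18 C C' \<Gamma>)
    let ?A = "{\<Gamma>}"
    have "{p \<in> ?X. fst p = \<Gamma> \<and> snd (snd p) \<inter> (C \<union> C') = {}}
        = {p \<in> ?X. fst p \<in> ?A \<and> snd (snd p) \<inter> (C \<union> C') = {}}"
      by auto
    moreover have "?A \<subseteq> Pow {..<M} - {{}}" using 18 by auto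
    ultimately have "card {p \<in> ?X. fst p = \<Gamma> \<and> snd (snd p) \<inter> (C \<union> C') = {}}
        = blocks M D I (card \<Gamma>) * card {S \<in> ksets N K. S \<inter> (C \<union> C') = {}}"
      using card_coordinates_restrict[of ?A M N K D I "\<lambda>S. S \<inter> (C \<union> C') = {}"] by simp
    then show ?case
      using card_ksets_avoiding_two[OF 18(1-4), of K] by (simp add: D)
  next
    case 12
    show ?case using pt(1) by auto
  qed (use assms(1-5) F G pt(2) finite_coordinates coordinatesD in \<open>simp_all\<close>)
  show ?thesis using scheme_properties by blast
qed

text \<open>\<open>Z\<close> is the number of blocks. Dividing the hypothesis by
  \<open>(D - I) * D ^ (M - 1)\<close> identifies \<open>Z / D ^ (M - 1)\<close> as the geometric
  sum.\<close>

lemma rate_formula: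
  fixes D I Z n M :: nat
  assumes "I < D" "1 \<le> M" "0 < n" and Z: "(D - I) * Z + I ^ M = D ^ M"
  shows "real (D ^ M) / real (Z * n) = real D / real n * inverse (\<Sum>j<M. (real I / real D) ^ j)"
proof -
  have D: "real D > 0" and ID: "real D - real I > 0" using assms by auto
  have "(real D - real I) * real Z + real I ^ M = real D ^ M"
    using arg_cong[OF Z, of real]
    unfolding of_nat_add of_nat_mult of_nat_power of_nat_diff[OF less_imp_le[OF assms(1)]] .
  then have Zr: "(real D - real I) * real Z = real D ^ M - real I ^ M" by simp
  have "real I ^ M < real D ^ M" using assms by (intro power_strict_mono) auto
  then have Z0: "real Z > 0" using Zr ID by (metis diff_gt_0_iff_gt zero_less_mult_pos)
  have "(\<Sum>j<M. (real I / real D) ^ j) = (1 - (real I / real D) ^ M) / (1 - real I / real D)"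
    using assms by (subst sum_gp_strict) auto
  also have "(1 - (real I / real D) ^ M) = (real D ^ M - real I ^ M) / real D ^ M"
    using D by (simp add: power_divide diff_divide_distrib)
  also have "1 - real I / real D = (real D - real I) / real D"
    using D by (simp add: diff_divide_distrib)
  also have "(real D ^ M - real I ^ M) / real D ^ M / ((real D - real I) / real D) = real Z * real D / real D ^ M"
    unfolding Zr[symmetric] using ID D by (simp add: field_simps)
  finally have geo: "(\<Sum>j<M. (real I / real D) ^ j) = real Z * real D / real D ^ M" .
  show ?thesis unfolding geo using D Z0 assms(3) by (simp add: field_simps)
qed

theorem theorem3:
  fixes N K T M B :: nat
  assumes "N \<ge> 1" and "K \<ge> 1" and "T \<ge> 1" and "M \<ge> 1"
    and "T + K \<le> N"
    and "2 * real ((N - B) choose K) - real (N choose K)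
           > real (N choose K) - real ((N - T) choose K)"
  defines "R \<equiv> (real (N choose K) - real ((N - T) choose K))
                / (2 * real ((N - B) choose K) - real (N choose K))"
  shows "\<exists>q0::nat. \<forall>F :: nat ring. field F \<and> finite (carrier F) \<and> card (carrier F) \<ge> q0 \<longrightarrow>
           (\<forall>G. mds_matrix F N K G \<longrightarrow>
              (\<exists>L \<ge> 1. \<exists>S :: nat_pir.
                 byzantine_pir_scheme F N K T M B L G S \<and>
                 (\<forall>i<M. pir_rate F N K M L G S i =
                    (2 * real ((N - B) choose K) - real (N choose K)) / real (N choose K)
                      * inverse (\<Sum>j<M. R ^ j))))"
proof -
  define D where "D = 2 * ((N - B) choose K) - (N choose K)"
  define I where "I = (N choose K) - ((N - T) choose K)"
  have le: "(N - T) choose K \<le> N choose K" by (rule binomial_right_mono) simp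
  then have rI: "real (N choose K) - real ((N - T) choose K) = real I"
    by (simp add: I_def of_nat_diff)
  \<comment> \<open>Makes the truncated subtraction in \<open>D\<close> a genuine one.\<close>
  have "real (2 * ((N - B) choose K)) > real (N choose K)"
    using assms(6) rI by simp
  then have rD: "2 * real ((N - B) choose K) - real (N choose K) = real D"
    by (simp add: D_def of_nat_diff)
  have ID: "I < D" using assms(6) unfolding rI rD by simp
  have "\<exists>L\<ge>1. \<exists>S :: nat_pir. byzantine_pir_scheme F N K T M B L G S \<and>
      (\<forall>i<M. pir_rate F N K M L G S i = real D / real (N choose K) * inverse (\<Sum>j<M. R ^ j))"
    if F: "field F" "finite (carrier F)" "card (coordinates M N K D I) \<le> card (carrier F)"
      and G: "mds_matrix F N K G" for F :: "nat ring" and G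
  proof -
    obtain S :: nat_pir where S: "byzantine_pir_scheme F N K T M B (D ^ M) G S"
      "\<forall>i<M. pir_rate F N K M (D ^ M) G S i = real (D ^ M) / real (card (coordinates M N K D I))"
      using pir_scheme_exists[OF assms(2,3,4) _ _ D_def I_def ID F G] assms(5) by auto
    have "real (D ^ M) / real (card (coordinates M N K D I))
        = real D / real (N choose K) * inverse (\<Sum>j<M. R ^ j)"
      unfolding card_coordinates R_def rI rD
      using assms(5) by (intro rate_formula[OF ID assms(4)] sum_blocks) (use ID in auto)
    moreover have "D ^ M \<ge> 1" using ID by simp
    ultimately show ?thesis using S by auto
  qed
  \<comment> \<open>The threshold \<open>q0\<close> is the number of coordinates, which depends on
    neither the field nor \<open>G\<close>.\<close>
  then show ?thesis unfolding rD by blast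
qed

end
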